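(* Let $G=(V,E)$ be a finite undirected loopless multigraph, let $o\in V$, let $B\subseteq V$, and let $p\in(0,1)$. Assume that $G$ is planar, equipped with a fixed planar embedding, and that every vertex of $\{o\}\cup B$ lies on the boundary of the outer face. Let $(\Omega,\mathcal F,\mathbb P)$ be a probability space carrying a random configuration $\pi=(\pi_e)_{e\in E}\in\{0,1\}^E$ whose coordinates are independent Bernoulli random variables with parameter $p$. Let $\varepsilon>0$, and let $(E_b)_{b\in B}$ be a family of events of $(\Omega,\mathcal F,\mathbb P)$ that are increasing with respect to the percolation configuration and satisfy $\mathbb P[E_b]\ge 1-\varepsilon$ for every $b\in B$. Then $$\mathbb P\Bigl[\bigcup_{b\in B}\bigl(\{o\longleftrightarrow b\}\cap E_b\bigr)\Bigr]\ \ge\ \bigl(1-2\sqrt{\varepsilon}\bigr)\,\mathbb P[o\longleftrightarrow B].$$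
   Context: Parallel edges are allowed and are regarded as distinct elements of $E$. An edge $e$ is open if $\pi_e=1$ and closed if $\pi_e=0$. For $u,v\in V$, $\{u\longleftrightarrow v\}$ is the event that $u$ and $v$ are joined by a path of open edges (a vertex is always connected to itself), and $\{o\longleftrightarrow B\}=\bigcup_{b\in B}\{o\longleftrightarrow b\}$. The probability space may carry additional randomness besides $\pi$; the events $E_b$ need not be measurable with respect to $\sigma(\pi)$. An event $A$ is called increasing with respect to the percolation configuration if the function $\omega\mapsto\mathbb P[A\mid \pi=\omega]$ is nondecreasing on $\{0,1\}^E$ for the coordinatewise partial order. *)

theory Defs
  imports "HOL-Probability.Probability"
begin

section \<open>Finite loopless multigraphs and open paths\<close>

text \<open>Edges are abstract elements of \<open>E\<close> and \<open>ends e\<close> is the set of end vertices of \<open>e\<close>; several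
  edges may share the same ends. The condition \<open>card (ends e) = 2\<close> rules out loops.\<close>

definition finite_loopless_multigraph :: "'v set \<Rightarrow> 'e set \<Rightarrow> ('e \<Rightarrow> 'v set) \<Rightarrow> bool" where
  "finite_loopless_multigraph V E ends \<longleftrightarrow>
     finite V \<and> finite E \<and> (\<forall>e\<in>E. ends e \<subseteq> V \<and> card (ends e) = 2)"

text \<open>A path through \<open>F\<close> consists of distinct vertices \<open>vs\<close> with consecutive ones joined by the
  edges \<open>es\<close>. The choice \<open>vs = [u]\<close>, \<open>es = []\<close> joins every vertex \<open>u\<close> to itself.\<close>

definition joined_by_path :: "'v set \<Rightarrow> ('e \<Rightarrow> 'v set) \<Rightarrow> 'e set \<Rightarrow> 'v \<Rightarrow> 'v \<Rightarrow> bool" where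
  "joined_by_path V ends F u v \<longleftrightarrow>
     (\<exists>vs es. length vs = Suc (length es) \<and> distinct vs \<and> set vs \<subseteq> V \<and> set es \<subseteq> F \<and>
        hd vs = u \<and> last vs = v \<and>
        (\<forall>i<length es. ends (es ! i) = {vs ! i, vs ! Suc i}))"

section \<open>Plane embeddings and the outer face\<close>

text \<open>The plane is \<^typ>\<open>complex\<close>. Edges are drawn as arbitrary simple arcs, whose relative interiors
  \<open>\<gamma> e ` {0<..<1}\<close> avoid all vertices and are pairwise disjoint.\<close>

definition planar_embedding ::
  "'v set \<Rightarrow> 'e set \<Rightarrow> ('e \<Rightarrow> 'v set) \<Rightarrow> ('v \<Rightarrow> complex) \<Rightarrow> ('e \<Rightarrow> real \<Rightarrow> complex) \<Rightarrow> bool" where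
  "planar_embedding V E ends \<phi> \<gamma> \<longleftrightarrow>
     inj_on \<phi> V \<and>
     (\<forall>e\<in>E. arc (\<gamma> e) \<and> {pathstart (\<gamma> e), pathfinish (\<gamma> e)} = \<phi> ` ends e \<and>
        \<gamma> e ` {0<..<1} \<inter> \<phi> ` V = {}) \<and>
     (\<forall>e\<in>E. \<forall>f\<in>E. e \<noteq> f \<longrightarrow> \<gamma> e ` {0<..<1} \<inter> \<gamma> f ` {0<..<1} = {})"

definition drawing ::
  "'v set \<Rightarrow> 'e set \<Rightarrow> ('v \<Rightarrow> complex) \<Rightarrow> ('e \<Rightarrow> real \<Rightarrow> complex) \<Rightarrow> complex set" where
  "drawing V E \<phi> \<gamma> = \<phi> ` V \<union> (\<Union>e\<in>E. path_image (\<gamma> e))"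

text \<open>The faces are the connected components of the complement of the drawing; the outer face is the
  unbounded one, see \<open>outer_face_iff\<close> below.\<close>

definition outer_face ::
  "'v set \<Rightarrow> 'e set \<Rightarrow> ('v \<Rightarrow> complex) \<Rightarrow> ('e \<Rightarrow> real \<Rightarrow> complex) \<Rightarrow> complex set" where
  "outer_face V E \<phi> \<gamma> = outside (drawing V E \<phi> \<gamma>)"

lemma outer_face_iff:
  assumes "finite_loopless_multigraph V E ends" and "planar_embedding V E ends \<phi> \<gamma>"
  shows "F = outer_face V E \<phi> \<gamma> \<longleftrightarrow> F \<in> components (- drawing V E \<phi> \<gamma>) \<and> \<not> bounded F"
proof -
  have "bounded (path_image (\<gamma> e))" if "e \<in> E" for e
    using assms(2) that by (auto simp: planar_embedding_def intro: bounded_arc_image)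
  then have "bounded (drawing V E \<phi> \<gamma>)"
    using assms(1) by (auto simp: drawing_def finite_loopless_multigraph_def finite_imp_bounded)
  then show ?thesis
    using bounded_unique_outside[of "drawing V E \<phi> \<gamma>" F] by (auto simp: outer_face_def)
qed

section \<open>Bernoulli percolation\<close>

text \<open>Configurations are Boolean, with \<^const>\<open>True\<close> for open (1) and \<^const>\<open>False\<close> for closed (0).\<close>

definition bernoulli_percolation :: "'w measure \<Rightarrow> 'e set \<Rightarrow> real \<Rightarrow> ('e \<Rightarrow> 'w \<Rightarrow> bool) \<Rightarrow> bool" where
  "bernoulli_percolation M E p \<pi> \<longleftrightarrow>
     prob_space.indep_vars M (\<lambda>_. count_space UNIV) \<pi> E \<and>
     (\<forall>e\<in>E. distr M (count_space UNIV) (\<pi> e) = measure_pmf (bernoulli_pmf p))"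

definition connection_event ::
  "'w measure \<Rightarrow> 'v set \<Rightarrow> 'e set \<Rightarrow> ('e \<Rightarrow> 'v set) \<Rightarrow> ('e \<Rightarrow> 'w \<Rightarrow> bool) \<Rightarrow> 'v \<Rightarrow> 'v \<Rightarrow> 'w set" where
  "connection_event M V E ends \<pi> u v = {x \<in> space M. joined_by_path V ends {e \<in> E. \<pi> e x} u v}"

text \<open>\<open>E \<rightarrow>\<^sub>E UNIV\<close> stands for \<open>{0,1}\<^sup>E\<close>: its members agree outside \<open>E\<close>, so the order on functions is
  the coordinatewise order over \<open>E\<close>. If \<open>E\<close> is finite and \<open>0 < p < 1\<close>, each configuration has positive
  probability and the elementary conditional probability is meaningful.\<close>

definition increasing_event :: "'w measure \<Rightarrow> 'e set \<Rightarrow> ('e \<Rightarrow> 'w \<Rightarrow> bool) \<Rightarrow> 'w set \<Rightarrow> bool" where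
  "increasing_event M E \<pi> A \<longleftrightarrow>
     mono_on (E \<rightarrow>\<^sub>E (UNIV :: bool set))
       (\<lambda>\<omega>. cond_prob M (\<lambda>x. x \<in> A) (\<lambda>x. \<forall>e\<in>E. \<pi> e x = \<omega> e))"

end

theory Submission
  imports Defs
begin

text \<open>The theorem is a statement about the cube of configurations. For a configuration \<open>\<omega>\<close> let
  \<open>g b \<omega>\<close> be the conditional probability, given \<open>\<omega>\<close>, that \<open>Ev b\<close> fails. Each \<open>g b\<close> is decreasing
  and has mean at most \<open>\<delta>\<^sup>2\<close>, where \<open>\<delta> = sqrt \<epsilon>\<close>. It suffices to select, for most configurations that
  connect \<open>r\<close> to \<open>B\<close>, a target \<open>b\<close> connected to \<open>r\<close> for which \<open>g b\<close> is at most \<open>\<delta>\<close> on average.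

  If \<open>B\<close> contains \<open>r\<close>, then \<open>r\<close> itself is selected. Otherwise the selection is an exploration.
  List \<open>B\<close> in the order \<open>b\<^sub>1, b\<^sub>2, \<dots>\<close> in which it is met when one walks
  along the outer face, starting at \<open>r\<close>. When \<open>b\<close> is reached, a set \<open>A\<close> of vertices has been
  explored; it is a union of open clusters, and exactly the states of the edges meeting \<open>A\<close> are
  known. If the mean of \<open>g b\<close> given this information exceeds \<open>\<delta>\<close>, then \<open>b\<close> is skipped; otherwise its
  cluster is added to \<open>A\<close>. The exploration succeeds, and ends, as soon as \<open>A\<close> contains \<open>r\<close>.

  Success is enough: given the information, the event that \<open>b\<close> is connected to \<open>r\<close> is increasing and
  \<open>g b\<close> is decreasing, so by Harris' inequality the mean of \<open>g b\<close> remains at most \<open>\<delta>\<close> when one also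
  conditions on success at \<open>b\<close> (\<open>success_bound\<close>).

  Failure is rare given that \<open>r\<close> is connected to \<open>B\<close> (\<open>failure_bound\<close>). In that case the last target \<open>b\<close>
  connected to \<open>r\<close> was skipped because of bad information, and by Markov's inequality bad
  information has probability at most \<open>\<delta>\<close>. The order now enters. A path from \<open>r\<close> to \<open>b\<close> separates the
  clusters explored before \<open>b\<close> from the clusters of the targets after \<open>b\<close>, so no edge meets both.
  Hence being the last target connected to \<open>r\<close> is not affected by any change of the edges that meet
  \<open>A\<close>, so the probability that this happens together with bad information is at most the
  product of the two probabilities.
  Together the two bounds give the factor \<open>(1 - \<delta>)\<^sup>2 \<ge> 1 - 2 * \<delta>\<close>.

  The order exists by plane topology (\<open>exists_noncrossing_order\<close>). Disjoint arcs through the outer face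
  join small neighbourhoods of the targets and of \<open>r\<close> to a horizontal line below the drawing. The
  targets are ordered as the feet of these arcs, read cyclically from the foot of \<open>r\<close>; two disjoint
  connected pieces of the drawing cannot join interlacing feet.\<close>

section \<open>Product weights on the cube and Harris' inequality\<close>

definition bernoulli_weight :: "real \<Rightarrow> 'e set \<Rightarrow> 'e set \<Rightarrow> real" where
  "bernoulli_weight p F S = (\<Prod>e\<in>F. if e \<in> S then p else 1 - p)"

definition cylinder :: "'e set \<Rightarrow> 'e set \<Rightarrow> 'e set \<Rightarrow> 'e set set" where
  "cylinder E I \<omega> = {\<omega>' \<in> Pow E. \<omega>' \<inter> I = \<omega> \<inter> I}"

lemma bernoulli_weight_nonneg: "0 \<le> p \<Longrightarrow> p \<le> 1 \<Longrightarrow> 0 \<le> bernoulli_weight p F S"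
  by (auto simp: bernoulli_weight_def intro!: prod_nonneg)

lemma bernoulli_weight_pos: "0 < p \<Longrightarrow> p < 1 \<Longrightarrow> 0 < bernoulli_weight p F S"
  by (auto simp: bernoulli_weight_def intro!: prod_pos)

lemma bernoulli_weight_cong:
  "S \<inter> F = S' \<inter> F \<Longrightarrow> bernoulli_weight p F S = bernoulli_weight p F S'"
  unfolding bernoulli_weight_def by (intro prod.cong) auto

lemma bernoulli_weight_split:
  assumes "finite E" "I \<subseteq> E"
  shows "bernoulli_weight p E S = bernoulli_weight p I S * bernoulli_weight p (E - I) S"
  unfolding bernoulli_weight_def using assms by (simp add: prod.subset_diff mult.commute)

lemma bernoulli_weight_insert:
  assumes "finite F" "e \<notin> F" "S \<subseteq> F"
  shows "bernoulli_weight p (insert e F) S = (1 - p) * bernoulli_weight p F S"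
    and "bernoulli_weight p (insert e F) (insert e S) = p * bernoulli_weight p F S"
proof -
  have "bernoulli_weight p F (insert e S) = bernoulli_weight p F S"
    using assms by (intro bernoulli_weight_cong) auto
  then show "bernoulli_weight p (insert e F) S = (1 - p) * bernoulli_weight p F S"
    "bernoulli_weight p (insert e F) (insert e S) = p * bernoulli_weight p F S"
    using assms by (auto simp: bernoulli_weight_def)
qed

lemma sum_Pow_insert:
  assumes "finite F" "e \<notin> F"
  shows "(\<Sum>S\<in>Pow (insert e F). h S) = (\<Sum>S\<in>Pow F. h S) + (\<Sum>S\<in>Pow F. h (insert e S))"
proof -
  have "inj_on (insert e) (Pow F)" using assms by (auto simp: inj_on_def)
  moreover have "Pow F \<inter> insert e ` Pow F = {}" using assms by auto
  ultimately show ?thesis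
    using assms by (simp add: Pow_insert sum.union_disjoint sum.reindex)
qed

lemma sum_bernoulli_weight:
  assumes "finite F"
  shows "(\<Sum>S\<in>Pow F. bernoulli_weight p F S) = 1"
  using assms
proof (induction F)
  case empty
  then show ?case by (simp add: bernoulli_weight_def)
next
  case (insert e F)
  then show ?case
    by (simp add: sum_Pow_insert bernoulli_weight_insert flip: sum_distrib_left)
qed

text \<open>Harris' inequality, by induction on the number of edges: conditionally on the state of the new edge
  the induction hypothesis applies, and what remains is the two-point Chebyshev inequality for
  the conditional means, whose defect is \<open>p * (1 - p) * (F1 - F0) * (G0 - G1)\<close>.\<close>

lemma harris:
  fixes f g :: "'e set \<Rightarrow> real"
  assumes "finite F" "0 \<le> p" "p \<le> 1"
    and "mono_on (Pow F) f" "antimono_on (Pow F) g"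
  shows "(\<Sum>S\<in>Pow F. bernoulli_weight p F S * (f S * g S))
       \<le> (\<Sum>S\<in>Pow F. bernoulli_weight p F S * f S) * (\<Sum>S\<in>Pow F. bernoulli_weight p F S * g S)"
  using assms(1,4,5)
proof (induction F arbitrary: f g)
  case empty
  then show ?case by (simp add: bernoulli_weight_def)
next
  case (insert e F)
  let ?w = "bernoulli_weight p F"
  define F0 F1 G0 G1 where "F0 = (\<Sum>S\<in>Pow F. ?w S * f S)" "F1 = (\<Sum>S\<in>Pow F. ?w S * f (insert e S))"
    "G0 = (\<Sum>S\<in>Pow F. ?w S * g S)" "G1 = (\<Sum>S\<in>Pow F. ?w S * g (insert e S))"
  note mono = monotone_onD[OF insert.prems(1)] monotone_onD[OF insert.prems(2)]
  have w: "?w S \<ge> 0" for S using assms bernoulli_weight_nonneg by auto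
  have split: "(\<Sum>S\<in>Pow (insert e F). bernoulli_weight p (insert e F) S * h S)
      = (1 - p) * (\<Sum>S\<in>Pow F. ?w S * h S) + p * (\<Sum>S\<in>Pow F. ?w S * h (insert e S))" for h
  proof -
    have "(\<Sum>S\<in>Pow F. bernoulli_weight p (insert e F) S * h S) = (1 - p) * (\<Sum>S\<in>Pow F. ?w S * h S)"
      using insert.hyps unfolding sum_distrib_left
      by (intro sum.cong) (auto simp: bernoulli_weight_insert)
    moreover have "(\<Sum>S\<in>Pow F. bernoulli_weight p (insert e F) (insert e S) * h (insert e S))
        = p * (\<Sum>S\<in>Pow F. ?w S * h (insert e S))"
      using insert.hyps unfolding sum_distrib_left
      by (intro sum.cong) (auto simp: bernoulli_weight_insert)
    ultimately show ?thesis using insert.hyps by (simp add: sum_Pow_insert)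
  qed
  have 0: "(\<Sum>S\<in>Pow F. ?w S * (f S * g S)) \<le> F0 * G0"
    unfolding F0_F1_G0_G1_def by (rule insert.IH) (auto intro!: monotone_onI mono)
  have 1: "(\<Sum>S\<in>Pow F. ?w S * (f (insert e S) * g (insert e S))) \<le> F1 * G1"
    unfolding F0_F1_G0_G1_def
    by (rule insert.IH) (auto intro!: monotone_onI mono)
  have "F0 \<le> F1" "G1 \<le> G0"
    unfolding F0_F1_G0_G1_def by (auto intro!: sum_mono mult_left_mono w mono)
  then have "0 \<le> (p * (1 - p)) * ((F1 - F0) * (G0 - G1))"
    using assms by (intro mult_nonneg_nonneg) auto
  moreover have "(1 - p) * (\<Sum>S\<in>Pow F. ?w S * (f S * g S))
      + p * (\<Sum>S\<in>Pow F. ?w S * (f (insert e S) * g (insert e S)))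
      \<le> (1 - p) * (F0 * G0) + p * (F1 * G1)"
    using assms by (intro add_mono mult_left_mono 0 1) auto
  ultimately have "(1 - p) * (\<Sum>S\<in>Pow F. ?w S * (f S * g S))
      + p * (\<Sum>S\<in>Pow F. ?w S * (f (insert e S) * g (insert e S)))
      \<le> ((1 - p) * F0 + p * F1) * ((1 - p) * G0 + p * G1)"
    by (simp add: algebra_simps)
  then show ?case
    unfolding split F0_F1_G0_G1_def .
qed

text \<open>Revealing the edges of \<open>I\<close> leaves a fresh product measure on the other edges.\<close>

lemma sum_cylinder:
  assumes "finite E" "I \<subseteq> E"
  shows "(\<Sum>\<omega>'\<in>cylinder E I \<omega>. bernoulli_weight p E \<omega>' * h \<omega>') =
    bernoulli_weight p I \<omega> *
      (\<Sum>S\<in>Pow (E - I). bernoulli_weight p (E - I) S * h ((\<omega> \<inter> I) \<union> S))"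
proof -
  have "(\<Sum>\<omega>'\<in>cylinder E I \<omega>. bernoulli_weight p E \<omega>' * h \<omega>')
      = (\<Sum>S\<in>Pow (E - I). bernoulli_weight p E ((\<omega> \<inter> I) \<union> S) * h ((\<omega> \<inter> I) \<union> S))"
    using assms
    by (intro sum.reindex_bij_witness[where i = "\<lambda>S. (\<omega> \<inter> I) \<union> S" and j = "\<lambda>S. S - I"])
      (auto simp: cylinder_def Un_Diff_Int Int_commute intro!: arg_cong2[where f="(*)"] arg_cong[where f=h] arg_cong[where f="bernoulli_weight p E"])
  also have "\<dots> = (\<Sum>S\<in>Pow (E - I). bernoulli_weight p I \<omega> * (bernoulli_weight p (E - I) S * h ((\<omega> \<inter> I) \<union> S)))"
  proof (intro sum.cong refl)
    fix S assume "S \<in> Pow (E - I)"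
    then have "bernoulli_weight p I ((\<omega> \<inter> I) \<union> S) = bernoulli_weight p I \<omega>"
      "bernoulli_weight p (E - I) ((\<omega> \<inter> I) \<union> S) = bernoulli_weight p (E - I) S"
      by (auto intro!: bernoulli_weight_cong)
    then show "bernoulli_weight p E ((\<omega> \<inter> I) \<union> S) * h ((\<omega> \<inter> I) \<union> S)
        = bernoulli_weight p I \<omega> * (bernoulli_weight p (E - I) S * h ((\<omega> \<inter> I) \<union> S))"
      using bernoulli_weight_split[OF assms, of p "(\<omega> \<inter> I) \<union> S"] by simp
  qed
  finally show ?thesis by (simp add: sum_distrib_left)
qed

lemma cylinder_weight:
  assumes "finite E" "I \<subseteq> E"
  shows "(\<Sum>\<omega>'\<in>cylinder E I \<omega>. bernoulli_weight p E \<omega>') = bernoulli_weight p I \<omega>"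
  using sum_cylinder[OF assms, where h = "\<lambda>_. 1"] assms
  by (simp add: sum_bernoulli_weight)

lemma harris_cylinder:
  fixes f g :: "'e set \<Rightarrow> real"
  assumes "finite E" "I \<subseteq> E" "0 \<le> p" "p \<le> 1"
    and "mono_on (Pow E) f" "antimono_on (Pow E) g"
  shows "(\<Sum>\<omega>'\<in>cylinder E I \<omega>. bernoulli_weight p E \<omega>')
       * (\<Sum>\<omega>'\<in>cylinder E I \<omega>. bernoulli_weight p E \<omega>' * (f \<omega>' * g \<omega>'))
       \<le> (\<Sum>\<omega>'\<in>cylinder E I \<omega>. bernoulli_weight p E \<omega>' * f \<omega>')
       * (\<Sum>\<omega>'\<in>cylinder E I \<omega>. bernoulli_weight p E \<omega>' * g \<omega>')"
proof -
  let ?w = "bernoulli_weight p (E - I)" and ?c = "bernoulli_weight p I \<omega>"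
  have "(\<Sum>S\<in>Pow (E - I). ?w S * (f ((\<omega> \<inter> I) \<union> S) * g ((\<omega> \<inter> I) \<union> S)))
      \<le> (\<Sum>S\<in>Pow (E - I). ?w S * f ((\<omega> \<inter> I) \<union> S)) * (\<Sum>S\<in>Pow (E - I). ?w S * g ((\<omega> \<inter> I) \<union> S))"
    using assms(1-4)
    by (intro harris)
      (auto intro!: monotone_onI monotone_onD[OF assms(5)] monotone_onD[OF assms(6)])
  then have "?c * ?c * (\<Sum>S\<in>Pow (E - I). ?w S * (f ((\<omega> \<inter> I) \<union> S) * g ((\<omega> \<inter> I) \<union> S)))
      \<le> ?c * ?c * ((\<Sum>S\<in>Pow (E - I). ?w S * f ((\<omega> \<inter> I) \<union> S)) * (\<Sum>S\<in>Pow (E - I). ?w S * g ((\<omega> \<inter> I) \<union> S)))"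
    by (intro mult_left_mono) auto
  then show ?thesis
    unfolding cylinder_weight[OF assms(1,2)] sum_cylinder[OF assms(1,2)] by (simp add: mult_ac)
qed

text \<open>The hypothesis says that membership in \<open>X\<close>, as seen from the cylinder, does not depend on the
  edges of \<open>I\<close>. So the part of \<open>X\<close> in the cylinder is the cylinder intersected with an event that
  depends on the edges outside \<open>I\<close> only and that implies \<open>X\<close>; the two factors are independent.\<close>

lemma cylinder_Int_le:
  assumes "finite E" "I \<subseteq> E" "0 \<le> p" "p \<le> 1" "X \<subseteq> Pow E"
    and resample: "\<And>\<omega>' \<zeta>. \<omega>' \<in> cylinder E I \<omega> \<inter> X \<Longrightarrow> \<zeta> \<subseteq> I \<Longrightarrow> \<zeta> \<union> (\<omega>' - I) \<in> X"
  shows "(\<Sum>\<omega>'\<in>cylinder E I \<omega> \<inter> X. bernoulli_weight p E \<omega>')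
    \<le> (\<Sum>\<omega>'\<in>cylinder E I \<omega>. bernoulli_weight p E \<omega>') * (\<Sum>\<omega>'\<in>X. bernoulli_weight p E \<omega>')"
proof -
  let ?w = "bernoulli_weight p E"
  let ?T = "{S \<in> Pow (E - I). (\<omega> \<inter> I) \<union> S \<in> X}"
  have fin: "finite (E - I)" "finite I" "finite X" "finite (cylinder E I \<omega>)"
    using assms(1,2,5) finite_subset[of I E] finite_subset[of X "Pow E"] by (auto simp: cylinder_def)
  have cyl: "(\<Sum>\<omega>'\<in>cylinder E I \<omega> \<inter> X. ?w \<omega>') = bernoulli_weight p I \<omega> * (\<Sum>S\<in>?T. bernoulli_weight p (E - I) S)"
  proof -
  have "(\<Sum>\<omega>'\<in>cylinder E I \<omega> \<inter> X. ?w \<omega>') = (\<Sum>\<omega>'\<in>cylinder E I \<omega>. ?w \<omega>' * of_bool (\<omega>' \<in> X))"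
    unfolding sum.inter_restrict[OF fin(4)] by (intro sum.cong) auto
  also have "\<dots> = bernoulli_weight p I \<omega> * (\<Sum>S\<in>?T. bernoulli_weight p (E - I) S)"
    unfolding sum_cylinder[OF assms(1,2)] using fin
    by (auto intro!: sum.mono_neutral_cong_right arg_cong2[where f="(*)"])
  finally show ?thesis .
  qed
  have "(\<Sum>S\<in>?T. bernoulli_weight p (E - I) S)
      = (\<Sum>S\<in>?T. (\<Sum>\<zeta>\<in>Pow I. bernoulli_weight p I \<zeta>) * bernoulli_weight p (E - I) S)"
    using fin by (simp add: sum_bernoulli_weight)
  also have "\<dots> = (\<Sum>(S, \<zeta>)\<in>?T \<times> Pow I. ?w (\<zeta> \<union> S))"
    unfolding sum_distrib_right sum.cartesian_product
  proof (intro sum.cong refl, clarify)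
    fix S \<zeta> assume "S \<subseteq> E - I" "\<zeta> \<subseteq> I"
    then have "bernoulli_weight p I (\<zeta> \<union> S) = bernoulli_weight p I \<zeta>"
      "bernoulli_weight p (E - I) (\<zeta> \<union> S) = bernoulli_weight p (E - I) S"
      by (auto intro!: bernoulli_weight_cong)
    then show "bernoulli_weight p I \<zeta> * bernoulli_weight p (E - I) S = ?w (\<zeta> \<union> S)"
      using bernoulli_weight_split[OF assms(1,2), of p "\<zeta> \<union> S"] by simp
  qed
  also have "\<dots> = (\<Sum>\<omega>'\<in>(\<lambda>(S, \<zeta>). \<zeta> \<union> S) ` (?T \<times> Pow I). ?w \<omega>')"
    by (subst sum.reindex) (auto simp: inj_on_def case_prod_unfold)
  also have "\<dots> \<le> (\<Sum>\<omega>'\<in>X. ?w \<omega>')"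
  proof (intro sum_mono2)
    show "(\<lambda>(S, \<zeta>). \<zeta> \<union> S) ` (?T \<times> Pow I) \<subseteq> X"
    proof clarify
      fix S \<zeta> assume S: "S \<subseteq> E - I" "(\<omega> \<inter> I) \<union> S \<in> X" and \<zeta>: "\<zeta> \<subseteq> I"
      then have "(\<omega> \<inter> I) \<union> S \<in> cylinder E I \<omega> \<inter> X"
        using assms(5) by (auto simp: cylinder_def)
      from resample[OF this \<zeta>] have "\<zeta> \<union> ((\<omega> \<inter> I) \<union> S - I) \<in> X" .
      moreover have "(\<omega> \<inter> I) \<union> S - I = S" using S by auto
      ultimately show "\<zeta> \<union> S \<in> X" by simp
    qed
  qed (use fin assms bernoulli_weight_nonneg in auto)
  finally show ?thesis
    unfolding cyl cylinder_weight[OF assms(1,2)]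
    using assms(3,4) by (intro mult_left_mono bernoulli_weight_nonneg)
qed

text \<open>If the revealed set of edges \<open>I \<omega>\<close> is determined by the states of its own edges, as for a stopping time,
  then the cylinders \<open>cylinder E (I \<omega>) \<omega>\<close> partition the cube, and it suffices to compare
  sums cylinder by cylinder.\<close>

lemma sum_le_stopping:
  fixes h h' :: "'e set \<Rightarrow> real"
  assumes "finite E"
    and stop: "\<And>\<omega> \<omega>'. \<omega> \<subseteq> E \<Longrightarrow> \<omega>' \<in> cylinder E (I \<omega>) \<omega> \<Longrightarrow> I \<omega>' = I \<omega>"
    and le: "\<And>\<omega>. \<omega> \<subseteq> E \<Longrightarrow> (\<Sum>\<omega>'\<in>cylinder E (I \<omega>) \<omega>. h \<omega>') \<le> (\<Sum>\<omega>'\<in>cylinder E (I \<omega>) \<omega>. h' \<omega>')"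
  shows "(\<Sum>\<omega>\<in>Pow E. h \<omega>) \<le> (\<Sum>\<omega>\<in>Pow E. h' \<omega>)"
proof -
  define c where "c \<omega> = cylinder E (I \<omega>) \<omega>" for \<omega>
  have cell: "{\<omega>' \<in> Pow E. c \<omega>' = c \<omega>} = cylinder E (I \<omega>) \<omega>" if "\<omega> \<subseteq> E" for \<omega>
  proof (intro equalityI subsetI)
    fix \<omega>' assume "\<omega>' \<in> {\<omega>' \<in> Pow E. c \<omega>' = c \<omega>}"
    then have "\<omega>' \<in> c \<omega>'" "c \<omega>' = c \<omega>" by (auto simp: c_def cylinder_def)
    then show "\<omega>' \<in> cylinder E (I \<omega>) \<omega>" by (simp add: c_def)
  next
    fix \<omega>' assume *: "\<omega>' \<in> cylinder E (I \<omega>) \<omega>"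
    then show "\<omega>' \<in> {\<omega>' \<in> Pow E. c \<omega>' = c \<omega>}"
      using stop[OF that *] by (auto simp: c_def cylinder_def)
  qed
  have group: "sum k (Pow E) = (\<Sum>y\<in>c ` Pow E. sum k {x \<in> Pow E. c x = y})" for k :: "'e set \<Rightarrow> real"
    using \<open>finite E\<close> by (intro sum.group[symmetric]) auto
  have "sum h {x \<in> Pow E. c x = y} \<le> sum h' {x \<in> Pow E. c x = y}" if "y \<in> c ` Pow E" for y
  proof -
    from that obtain \<omega> where "\<omega> \<subseteq> E" "y = c \<omega>" by auto
    then show ?thesis using le[of \<omega>] cell[of \<omega>] by simp
  qed
  then have "(\<Sum>y\<in>c ` Pow E. sum h {x \<in> Pow E. c x = y}) \<le> (\<Sum>y\<in>c ` Pow E. sum h' {x \<in> Pow E. c x = y})"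
    by (rule sum_mono)
  then show ?thesis by (simp add: group)
qed

section \<open>Clusters and linked vertex sets\<close>

definition cluster :: "('e \<Rightarrow> 'v set) \<Rightarrow> 'e set \<Rightarrow> 'v \<Rightarrow> 'v set" where
  "cluster ends \<omega> u = {v. (\<lambda>x y. \<exists>e\<in>\<omega>. ends e = {x, y})\<^sup>*\<^sup>* u v}"

definition incident_edges :: "('e \<Rightarrow> 'v set) \<Rightarrow> 'e set \<Rightarrow> 'v set \<Rightarrow> 'e set" where
  "incident_edges ends E A = {e \<in> E. ends e \<inter> A \<noteq> {}}"

definition linked_within :: "('e \<Rightarrow> 'v set) \<Rightarrow> 'e set \<Rightarrow> 'v set \<Rightarrow> 'v \<Rightarrow> 'v \<Rightarrow> bool" where
  "linked_within ends E S u v \<longleftrightarrow>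
     u \<in> S \<and> (\<lambda>x y. x \<in> S \<and> y \<in> S \<and> (\<exists>e\<in>E. ends e = {x, y}))\<^sup>*\<^sup>* u v"

text \<open>The combinatorial trace of planarity. The connections here may use all edges, open or
  closed, because the exploration also looks at the closed edges on the boundary of a cluster.\<close>

definition noncrossing_order :: "('e \<Rightarrow> 'v set) \<Rightarrow> 'e set \<Rightarrow> 'v \<Rightarrow> 'v list \<Rightarrow> bool" where
  "noncrossing_order ends E r bs \<longleftrightarrow>
     (\<forall>pre b post i k S S'. bs = pre @ b # post \<longrightarrow> i \<in> set pre \<longrightarrow> k \<in> set post \<longrightarrow>
        linked_within ends E S r b \<longrightarrow> linked_within ends E S' i k \<longrightarrow> S \<inter> S' \<noteq> {})"

lemma self_in_cluster [simp]: "u \<in> cluster ends \<omega> u"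
  by (simp add: cluster_def)

lemma cluster_trans:
  "v \<in> cluster ends \<omega> u \<Longrightarrow> w \<in> cluster ends \<omega> v \<Longrightarrow> w \<in> cluster ends \<omega> u"
  unfolding cluster_def by auto

lemma cluster_step:
  "x \<in> cluster ends \<omega> u \<Longrightarrow> e \<in> \<omega> \<Longrightarrow> ends e = {x, y} \<Longrightarrow> y \<in> cluster ends \<omega> u"
  unfolding cluster_def by (auto intro: rtranclp.rtrancl_into_rtrancl)

lemma cluster_sym:
  assumes "v \<in> cluster ends \<omega> u"
  shows "u \<in> cluster ends \<omega> v"
proof -
  have "symp (\<lambda>x y. \<exists>e\<in>\<omega>. ends e = {x, y})"
    by (auto intro!: sympI simp: insert_commute)
  then have "symp (\<lambda>x y. \<exists>e\<in>\<omega>. ends e = {x, y})\<^sup>*\<^sup>*"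
    by (rule symp_rtranclp)
  then show ?thesis using assms by (auto simp: cluster_def dest: sympD)
qed

lemma cluster_commute: "v \<in> cluster ends \<omega> u \<longleftrightarrow> u \<in> cluster ends \<omega> v"
  by (blast intro: cluster_sym)

lemma cluster_mono: "\<omega> \<subseteq> \<omega>' \<Longrightarrow> cluster ends \<omega> u \<subseteq> cluster ends \<omega>' u"
  unfolding cluster_def by (auto elim!: rtranclp_mono[THEN predicate2D, rotated])

lemma cluster_subset_local:
  assumes "\<And>e x y. e \<in> \<omega> \<Longrightarrow> ends e = {x, y} \<Longrightarrow> x \<in> cluster ends \<omega> u \<Longrightarrow> e \<in> \<omega>'"
  shows "cluster ends \<omega> u \<subseteq> cluster ends \<omega>' u"
proof
  fix v assume "v \<in> cluster ends \<omega> u"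
  then have "(\<lambda>x y. \<exists>e\<in>\<omega>. ends e = {x, y})\<^sup>*\<^sup>* u v" by (simp add: cluster_def)
  then show "v \<in> cluster ends \<omega>' u"
  proof induction
    case (step y z)
    then show ?case using assms[of _ y z] by (auto simp: cluster_def intro: rtranclp.rtrancl_into_rtrancl)
  qed simp
qed

text \<open>A cluster is determined by the states of the edges that meet it.\<close>

lemma cluster_cong_local:
  assumes "\<omega> \<subseteq> E" "\<omega>' \<subseteq> E"
    and "\<omega> \<inter> incident_edges ends E (cluster ends \<omega> u) = \<omega>' \<inter> incident_edges ends E (cluster ends \<omega> u)"
  shows "cluster ends \<omega>' u = cluster ends \<omega> u"
proof
  have agree: "e \<in> \<omega> \<longleftrightarrow> e \<in> \<omega>'" if "ends e = {x, y}" "x \<in> cluster ends \<omega> u" for e x y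
  proof -
    have "x \<in> ends e \<inter> cluster ends \<omega> u" using that by simp
    then have "e \<in> incident_edges ends E (cluster ends \<omega> u) \<longleftrightarrow> e \<in> E"
      by (auto simp: incident_edges_def)
    then show ?thesis using assms by blast
  qed
  then show "cluster ends \<omega> u \<subseteq> cluster ends \<omega>' u"
    by (intro cluster_subset_local) blast
  show "cluster ends \<omega>' u \<subseteq> cluster ends \<omega> u"
  proof
    fix v assume "v \<in> cluster ends \<omega>' u"
    then have "(\<lambda>x y. \<exists>e\<in>\<omega>'. ends e = {x, y})\<^sup>*\<^sup>* u v" by (simp add: cluster_def)
    then show "v \<in> cluster ends \<omega> u"
    proof induction
      case (step y z)
      then show ?case using agree cluster_step by metis
    qed simp
  qed
qed

lemma linked_within_mono:
  assumes "linked_within ends F S u v" "F \<subseteq> E" "S \<subseteq> T"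
  shows "linked_within ends E T u v"
  using assms unfolding linked_within_def
  by (auto elim!: rtranclp_mono[THEN predicate2D, rotated])

lemma linked_within_trans:
  "linked_within ends E S u v \<Longrightarrow> linked_within ends E S v w \<Longrightarrow> linked_within ends E S u w"
  unfolding linked_within_def by auto

lemma linked_within_edge:
  "e \<in> E \<Longrightarrow> ends e = {u, v} \<Longrightarrow> u \<in> S \<Longrightarrow> v \<in> S \<Longrightarrow> linked_within ends E S u v"
  unfolding linked_within_def by (auto intro!: r_into_rtranclp)

lemma linked_within_sym:
  assumes "linked_within ends E S u v"
  shows "linked_within ends E S v u"
proof -
  let ?R = "\<lambda>x y. x \<in> S \<and> y \<in> S \<and> (\<exists>e\<in>E. ends e = {x, y})"
  have "?R\<^sup>*\<^sup>* u v" "u \<in> S" using assms by (auto simp: linked_within_def)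
  then have "v \<in> S" by (induction) auto
  have "symp ?R" by (auto intro!: sympI simp: insert_commute)
  then have "symp ?R\<^sup>*\<^sup>*" by (rule symp_rtranclp)
  with \<open>?R\<^sup>*\<^sup>* u v\<close> \<open>v \<in> S\<close> show ?thesis by (auto simp: linked_within_def dest: sympD)
qed

lemma linked_within_mem: "linked_within ends E S u v \<Longrightarrow> u \<in> S \<and> v \<in> S"
  using linked_within_sym by (metis linked_within_def)

lemma linked_within_restrict:
  assumes "linked_within ends E S u v" "u \<in> V" "\<And>e. e \<in> E \<Longrightarrow> ends e \<subseteq> V"
  shows "linked_within ends E (S \<inter> V) u v"
proof -
  let ?R = "\<lambda>T x y. x \<in> T \<and> y \<in> T \<and> (\<exists>e\<in>E. ends e = {x, y})"
  have "?R S x y \<Longrightarrow> ?R (S \<inter> V) x y" for x y using assms(3) by blast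
  then have "(?R S)\<^sup>*\<^sup>* \<le> (?R (S \<inter> V))\<^sup>*\<^sup>*" by (intro rtranclp_mono) blast
  then show ?thesis using assms by (auto simp: linked_within_def)
qed

lemma linked_within_cluster:
  assumes "u \<in> cluster ends \<omega> b" "v \<in> cluster ends \<omega> b"
  shows "linked_within ends \<omega> (cluster ends \<omega> b) u v"
proof -
  have "v \<in> cluster ends \<omega> u" using assms cluster_sym cluster_trans by metis
  then have "(\<lambda>x y. \<exists>e\<in>\<omega>. ends e = {x, y})\<^sup>*\<^sup>* u v" by (simp add: cluster_def)
  then have "v \<in> cluster ends \<omega> b \<and> linked_within ends \<omega> (cluster ends \<omega> b) u v"
  proof induction
    case base
    then show ?case using assms by (simp add: linked_within_def)
  next
    case (step y z)
    then obtain e where e: "e \<in> \<omega>" "ends e = {y, z}" by blast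
    then have "z \<in> cluster ends \<omega> b" using step cluster_step by metis
    then show ?case using e step linked_within_trans linked_within_edge by metis
  qed
  then show ?thesis ..
qed

section \<open>Exploring the targets one by one\<close>

locale exploration =
  fixes E :: "'e set" and ends :: "'e \<Rightarrow> 'v set" and p \<delta> :: real and r :: 'v
    and g :: "'v \<Rightarrow> 'e set \<Rightarrow> real" and bs :: "'v list"
  assumes finite_E: "finite E"
    and card_ends: "\<And>e. e \<in> E \<Longrightarrow> card (ends e) = 2"
    and p: "0 < p" "p < 1" and \<delta>: "0 < \<delta>"
    and g_antimono: "\<And>b. b \<in> set bs \<Longrightarrow> antimono_on (Pow E) (g b)"
    and g_nonneg: "\<And>b \<omega>. b \<in> set bs \<Longrightarrow> \<omega> \<subseteq> E \<Longrightarrow> 0 \<le> g b \<omega>"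
    and g_mean: "\<And>b. b \<in> set bs \<Longrightarrow> (\<Sum>\<omega>\<in>Pow E. bernoulli_weight p E \<omega> * g b \<omega>) \<le> \<delta>\<^sup>2"
    and order: "noncrossing_order ends E r bs"
begin

abbreviation "W \<equiv> bernoulli_weight p E"
abbreviation "cl \<equiv> cluster ends"
abbreviation "inc \<equiv> incident_edges ends E"

text \<open>The conditional mean of \<open>g b\<close>, given the states of the edges meeting \<open>A\<close>, is at most \<open>\<delta>\<close>; the
  denominator is cleared.\<close>

definition good :: "'v \<Rightarrow> 'v set \<Rightarrow> 'e set \<Rightarrow> bool" where
  "good b A \<omega> \<longleftrightarrow>
     (\<Sum>\<omega>'\<in>cylinder E (inc A) \<omega>. W \<omega>' * g b \<omega>') \<le> \<delta> * (\<Sum>\<omega>'\<in>cylinder E (inc A) \<omega>. W \<omega>')"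

definition explore_step :: "'e set \<Rightarrow> 'v set \<Rightarrow> 'v \<Rightarrow> 'v set" where
  "explore_step \<omega> A b = (if r \<notin> A \<and> good b A \<omega> then A \<union> cl \<omega> b else A)"

definition explore :: "'v list \<Rightarrow> 'e set \<Rightarrow> 'v set" where
  "explore xs \<omega> = foldl (explore_step \<omega>) {} xs"

lemma explore_Nil [simp]: "explore [] \<omega> = {}"
  by (simp add: explore_def)

lemma explore_snoc: "explore (xs @ [b]) \<omega> = explore_step \<omega> (explore xs \<omega>) b"
  by (simp add: explore_def)

lemma W_pos: "0 < W \<omega>"
  using bernoulli_weight_pos p by blast

lemma inc_subset: "inc A \<subseteq> E"
  by (auto simp: incident_edges_def)

lemma inc_mono: "A \<subseteq> A' \<Longrightarrow> inc A \<subseteq> inc A'"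
  by (auto simp: incident_edges_def)

lemma explore_mono: "explore xs \<omega> \<subseteq> explore (xs @ ys) \<omega>"
proof (induction ys rule: rev_induct)
  case (snoc y ys)
  then show ?case
    using explore_snoc[of "xs @ ys" y \<omega>] by (auto simp: explore_step_def)
qed simp

lemma explore_is_union_of_clusters:
  "x \<in> explore xs \<omega> \<Longrightarrow> \<exists>b\<in>set xs. x \<in> cl \<omega> b \<and> cl \<omega> b \<subseteq> explore xs \<omega>"
proof (induction xs rule: rev_induct)
  case (snoc y ys)
  show ?case
  proof (cases "x \<in> explore ys \<omega>")
    case True
    then obtain b where "b \<in> set ys" "x \<in> cl \<omega> b" "cl \<omega> b \<subseteq> explore ys \<omega>" using snoc.IH by blast
    moreover from this have "cl \<omega> b \<subseteq> explore (ys @ [y]) \<omega>" using explore_mono[of ys \<omega> "[y]"] by blast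
    ultimately show ?thesis by auto
  next
    case False
    then have "x \<in> cl \<omega> y" "cl \<omega> y \<subseteq> explore (ys @ [y]) \<omega>"
      using snoc.prems by (auto simp: explore_snoc explore_step_def split: if_splits)
    then show ?thesis by auto
  qed
qed simp

lemma good_cong: "\<omega> \<inter> inc A = \<omega>' \<inter> inc A \<Longrightarrow> good b A \<omega> = good b A \<omega>'"
  by (simp add: good_def cylinder_def)

text \<open>The explored set has the stopping property required by \<open>sum_le_stopping\<close>: each decision
  of the exploration depends on edges that meet the set explored up to then, and a cluster that is
  added is determined by edges that meet it.\<close>

lemma explore_stopping:
  assumes "\<omega> \<subseteq> E" "\<omega>' \<subseteq> E" "\<omega>' \<inter> inc (explore xs \<omega>) = \<omega> \<inter> inc (explore xs \<omega>)"
  shows "explore xs \<omega>' = explore xs \<omega>"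
  using assms(3)
proof (induction xs rule: rev_induct)
  case (snoc b xs)
  have agree: "\<omega>' \<inter> inc A = \<omega> \<inter> inc A" if "A \<subseteq> explore (xs @ [b]) \<omega>" for A
    using snoc.prems inc_mono[OF that] by blast
  have eq: "explore xs \<omega>' = explore xs \<omega>"
    using snoc.IH agree explore_mono by blast
  have good: "good b (explore xs \<omega>) \<omega>' = good b (explore xs \<omega>) \<omega>"
    by (intro good_cong agree explore_mono)
  show ?case
  proof (cases "r \<notin> explore xs \<omega> \<and> good b (explore xs \<omega>) \<omega>")
    case True
    then have "cl \<omega> b \<subseteq> explore (xs @ [b]) \<omega>" by (auto simp: explore_snoc explore_step_def)
    then have "cl \<omega>' b = cl \<omega> b"
      using assms agree by (intro cluster_cong_local[of _ E]) auto
    then show ?thesis using eq good by (simp add: explore_snoc explore_step_def)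
  next
    case False
    then show ?thesis using eq good by (auto simp: explore_snoc explore_step_def)
  qed
qed simp

lemma explore_cylinder:
  assumes "\<omega> \<subseteq> E" "\<omega>' \<in> cylinder E (inc (explore xs \<omega>)) \<omega>"
  shows "explore xs \<omega>' = explore xs \<omega>"
    and "good b (explore xs \<omega>) \<omega>' = good b (explore xs \<omega>) \<omega>"
proof -
  show "explore xs \<omega>' = explore xs \<omega>"
    using assms by (intro explore_stopping) (auto simp: cylinder_def)
  show "good b (explore xs \<omega>) \<omega>' = good b (explore xs \<omega>) \<omega>"
    using assms by (intro good_cong) (auto simp: cylinder_def)
qed

lemma sum_le_explore:
  fixes h h' :: "'e set \<Rightarrow> real"
  assumes "\<And>\<omega>. \<omega> \<subseteq> E \<Longrightarrow> (\<Sum>\<omega>'\<in>cylinder E (inc (explore xs \<omega>)) \<omega>. h \<omega>')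
      \<le> (\<Sum>\<omega>'\<in>cylinder E (inc (explore xs \<omega>)) \<omega>. h' \<omega>')"
  shows "(\<Sum>\<omega>\<in>Pow E. h \<omega>) \<le> (\<Sum>\<omega>\<in>Pow E. h' \<omega>)"
  using sum_le_stopping[OF finite_E _ assms] explore_cylinder(1) by metis

lemma finite_cylinder: "finite (cylinder E I \<omega>)"
  using finite_E by (simp add: cylinder_def)

text \<open>On each cylinder of the information available before \<open>b\<close>, the decision whether to explore \<open>b\<close> is already
  taken, and success at \<open>b\<close> is the increasing event that \<open>b\<close> is connected to \<open>r\<close>. Harris' inequality on
  the cylinder shows that success does not increase the mean of the decreasing function \<open>g b\<close>.\<close>

lemma success_step:
  assumes b: "b \<in> set bs"
  shows "(\<Sum>\<omega> | \<omega> \<subseteq> E \<and> r \<notin> explore xs \<omega> \<and> r \<in> explore (xs @ [b]) \<omega>. W \<omega> * g b \<omega>)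
    \<le> \<delta> * (\<Sum>\<omega> | \<omega> \<subseteq> E \<and> r \<notin> explore xs \<omega> \<and> r \<in> explore (xs @ [b]) \<omega>. W \<omega>)"
proof -
  define succ where "succ \<omega> \<longleftrightarrow> r \<notin> explore xs \<omega> \<and> r \<in> explore (xs @ [b]) \<omega>" for \<omega>
  have succ_iff: "succ \<omega> \<longleftrightarrow> r \<notin> explore xs \<omega> \<and> good b (explore xs \<omega>) \<omega> \<and> r \<in> cl \<omega> b" for \<omega>
    by (auto simp: succ_def explore_snoc explore_step_def)
  have "(\<Sum>\<omega>\<in>Pow E. W \<omega> * (of_bool (succ \<omega>) * g b \<omega>)) \<le> (\<Sum>\<omega>\<in>Pow E. \<delta> * (W \<omega> * of_bool (succ \<omega>)))"
  proof (rule sum_le_explore)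
    fix \<omega> assume \<omega>: "\<omega> \<subseteq> E"
    let ?C = "cylinder E (inc (explore xs \<omega>)) \<omega>"
    show "(\<Sum>\<omega>'\<in>?C. W \<omega>' * (of_bool (succ \<omega>') * g b \<omega>')) \<le> (\<Sum>\<omega>'\<in>?C. \<delta> * (W \<omega>' * of_bool (succ \<omega>')))"
    proof (cases "r \<notin> explore xs \<omega> \<and> good b (explore xs \<omega>) \<omega>")
      case True
      then have succ: "succ \<omega>' \<longleftrightarrow> r \<in> cl \<omega>' b" if "\<omega>' \<in> ?C" for \<omega>'
        using explore_cylinder[OF \<omega> that] by (simp add: succ_iff)
      let ?f = "\<lambda>\<omega>'. of_bool (r \<in> cl \<omega>' b) :: real"
      have Cpos: "0 < (\<Sum>\<omega>'\<in>?C. W \<omega>')"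
        using \<omega> W_pos finite_cylinder by (intro sum_pos) (auto simp: cylinder_def)
      have "mono_on (Pow E) ?f"
        using cluster_mono by (fastforce intro!: monotone_onI)
      then have "(\<Sum>\<omega>'\<in>?C. W \<omega>') * (\<Sum>\<omega>'\<in>?C. W \<omega>' * (?f \<omega>' * g b \<omega>'))
          \<le> (\<Sum>\<omega>'\<in>?C. W \<omega>' * ?f \<omega>') * (\<Sum>\<omega>'\<in>?C. W \<omega>' * g b \<omega>')"
        using finite_E inc_subset p g_antimono[OF b] by (intro harris_cylinder) auto
      also have "\<dots> \<le> (\<Sum>\<omega>'\<in>?C. W \<omega>' * ?f \<omega>') * (\<delta> * (\<Sum>\<omega>'\<in>?C. W \<omega>'))"
        using True W_pos by (intro mult_left_mono sum_nonneg) (auto simp: good_def less_imp_le)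
      finally have "(\<Sum>\<omega>'\<in>?C. W \<omega>') * (\<Sum>\<omega>'\<in>?C. W \<omega>' * (?f \<omega>' * g b \<omega>'))
        \<le> (\<Sum>\<omega>'\<in>?C. W \<omega>') * (\<delta> * (\<Sum>\<omega>'\<in>?C. W \<omega>' * ?f \<omega>'))"
        by (simp add: mult_ac)
      then have "(\<Sum>\<omega>'\<in>?C. W \<omega>' * (?f \<omega>' * g b \<omega>')) \<le> \<delta> * (\<Sum>\<omega>'\<in>?C. W \<omega>' * ?f \<omega>')"
        using Cpos by simp
      then show ?thesis using succ by (simp add: sum_distrib_left cong: sum.cong)
    next
      case False
      then have "\<not> succ \<omega>'" if "\<omega>' \<in> ?C" for \<omega>'
        using explore_cylinder[OF \<omega> that] by (auto simp: succ_iff)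
      then show ?thesis by simp
    qed
  qed
  moreover have "(\<Sum>\<omega>\<in>Pow E. W \<omega> * (of_bool (succ \<omega>) * g b \<omega>)) = (\<Sum>\<omega> | \<omega> \<subseteq> E \<and> succ \<omega>. W \<omega> * g b \<omega>)"
    using finite_E by (intro sum.mono_neutral_cong_right) auto
  moreover have "(\<Sum>\<omega>\<in>Pow E. \<delta> * (W \<omega> * of_bool (succ \<omega>))) = (\<Sum>\<omega> | \<omega> \<subseteq> E \<and> succ \<omega>. \<delta> * W \<omega>)"
    using finite_E by (intro sum.mono_neutral_cong_right) auto
  ultimately show ?thesis
    by (simp add: succ_def sum_distrib_left)
qed

text \<open>Here the order of the targets enters. The cluster of \<open>b\<close> contains \<open>r\<close> and therefore avoids the
  explored set \<open>A\<close>, so a resampling of the edges meeting \<open>A\<close> leaves \<open>b\<close> connected to \<open>r\<close>. It also leaves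
  the clusters of the later targets \<open>k\<close> unchanged: an edge that meets \<open>A\<close> and the cluster of \<open>k\<close> would link
  an earlier target to \<open>k\<close> without touching the cluster of \<open>b\<close>, against the order.\<close>

lemma resample_left:
  assumes split: "bs = pre @ b # post" and \<omega>: "\<omega> \<subseteq> E"
    and rA: "r \<notin> explore pre \<omega>" and rb: "r \<in> cl \<omega> b" and last: "\<forall>k\<in>set post. r \<notin> cl \<omega> k"
    and \<zeta>: "\<zeta> \<subseteq> inc (explore pre \<omega>)"
  defines "\<omega>' \<equiv> \<zeta> \<union> (\<omega> - inc (explore pre \<omega>))"
  shows "r \<in> cl \<omega>' b" and "\<forall>k\<in>set post. r \<notin> cl \<omega>' k"
proof -
  let ?A = "explore pre \<omega>"
  have disj: "cl \<omega> b \<inter> ?A = {}"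
  proof (rule ccontr)
    assume "cl \<omega> b \<inter> ?A \<noteq> {}"
    then obtain x i where "x \<in> cl \<omega> b" "x \<in> cl \<omega> i" "cl \<omega> i \<subseteq> ?A"
      using explore_is_union_of_clusters by blast
    then have "r \<in> ?A" using rb cluster_sym cluster_trans by (metis subsetD)
    then show False using rA by simp
  qed
  have "cl \<omega> b \<subseteq> cl \<omega>' b"
  proof (rule cluster_subset_local)
    fix e x y assume "e \<in> \<omega>" "ends e = {x, y}" "x \<in> cl \<omega> b"
    moreover from this have "y \<in> cl \<omega> b" using cluster_step by metis
    ultimately show "e \<in> \<omega>'"
      using disj by (auto simp: \<omega>'_def incident_edges_def)
  qed
  then show "r \<in> cl \<omega>' b" using rb by blast
  show "\<forall>k\<in>set post. r \<notin> cl \<omega>' k"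
  proof
    fix k assume k: "k \<in> set post"
    have "inc (cl \<omega> k) \<inter> inc ?A = {}"
    proof (rule ccontr)
      assume "inc (cl \<omega> k) \<inter> inc ?A \<noteq> {}"
      then obtain e u v where e: "e \<in> E" "u \<in> ends e" "u \<in> ?A" "v \<in> ends e" "v \<in> cl \<omega> k"
        by (auto simp: incident_edges_def)
      obtain i where i: "i \<in> set pre" "u \<in> cl \<omega> i" "cl \<omega> i \<subseteq> ?A"
        using explore_is_union_of_clusters e by blast
      let ?S' = "cl \<omega> i \<union> cl \<omega> k"
      have "linked_within ends E ?S' u v"
      proof (cases "u = v")
        case True
        then show ?thesis using i by (simp add: linked_within_def)
      next
        case False
        then have "ends e = {u, v}"
          using card_ends[OF e(1)] e by (auto simp: card_2_iff)
        then show ?thesis using e i by (intro linked_within_edge) auto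
      qed
      moreover have "linked_within ends E ?S' i u"
        using linked_within_mono[OF linked_within_cluster[of i ends \<omega> i u]] i \<omega> by auto
      moreover have "linked_within ends E ?S' v k"
        using linked_within_mono[OF linked_within_cluster[of v ends \<omega> k k]] e \<omega> by auto
      ultimately have "linked_within ends E ?S' i k"
        using linked_within_trans by metis
      moreover have "linked_within ends E (cl \<omega> b) r b"
        using linked_within_mono[OF linked_within_cluster[of r ends \<omega> b b]] rb \<omega> by auto
      ultimately have "cl \<omega> b \<inter> ?S' \<noteq> {}"
        using order split i k unfolding noncrossing_order_def by metis
      then obtain x where "x \<in> cl \<omega> b" "x \<in> cl \<omega> k"
        using disj i by blast
      then have "r \<in> cl \<omega> k" using rb cluster_sym cluster_trans by metis
      then show False using last k by blast
    qed
    then have "cl \<omega>' k = cl \<omega> k"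
      using \<omega> subset_trans[OF \<zeta> inc_subset] \<zeta> by (intro cluster_cong_local[of _ E]) (auto simp: \<omega>'_def)
    then show "r \<notin> cl \<omega>' k" using last k by simp
  qed
qed

text \<open>Let \<open>Y\<close> be the event that \<open>b\<close> is the last target connected to \<open>r\<close>. If the exploration fails on \<open>Y\<close>, then the
  information before \<open>b\<close> is bad: \<open>b\<close> was skipped although \<open>r\<close> had not been found. By \<open>resample_left\<close>,
  \<open>Y\<close> has conditional probability at most \<open>PY\<close> on every bad cylinder, and the bad cylinders have total
  probability at most \<open>\<delta>\<close> by Markov's inequality, since the mean of \<open>g b\<close> is at most \<open>\<delta>\<^sup>2\<close>.\<close>

lemma failure_step:
  assumes split: "bs = pre @ b # post"
  shows "(\<Sum>\<omega> | \<omega> \<subseteq> E \<and> r \<notin> explore bs \<omega> \<and> r \<in> cl \<omega> b \<and> (\<forall>k\<in>set post. r \<notin> cl \<omega> k). W \<omega>)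
    \<le> \<delta> * (\<Sum>\<omega> | \<omega> \<subseteq> E \<and> r \<in> cl \<omega> b \<and> (\<forall>k\<in>set post. r \<notin> cl \<omega> k). W \<omega>)"
proof -
  have b: "b \<in> set bs" using split by simp
  define Y where "Y = {\<omega>. \<omega> \<subseteq> E \<and> r \<in> cl \<omega> b \<and> (\<forall>k\<in>set post. r \<notin> cl \<omega> k)}"
  define PY where "PY = (\<Sum>\<omega>\<in>Y. W \<omega>)"
  define bad where "bad \<omega> \<longleftrightarrow> r \<notin> explore pre \<omega> \<and> \<not> good b (explore pre \<omega>) \<omega>" for \<omega>
  have PY: "0 \<le> PY" unfolding PY_def using W_pos by (intro sum_nonneg) (simp add: less_imp_le)
  have bad_cyl: "bad \<omega>' = bad \<omega>" if "\<omega> \<subseteq> E" "\<omega>' \<in> cylinder E (inc (explore pre \<omega>)) \<omega>" for \<omega> \<omega>'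
    using explore_cylinder[OF that] by (simp add: bad_def)
  have "(\<Sum>\<omega> | \<omega> \<subseteq> E \<and> r \<notin> explore bs \<omega> \<and> r \<in> cl \<omega> b \<and> (\<forall>k\<in>set post. r \<notin> cl \<omega> k). W \<omega>)
      \<le> (\<Sum>\<omega>\<in>{\<omega> \<in> Pow E. \<omega> \<in> Y \<and> bad \<omega>}. W \<omega>)"
  proof (rule sum_mono2)
    show "{\<omega>. \<omega> \<subseteq> E \<and> r \<notin> explore bs \<omega> \<and> r \<in> cl \<omega> b \<and> (\<forall>k\<in>set post. r \<notin> cl \<omega> k)}
        \<subseteq> {\<omega> \<in> Pow E. \<omega> \<in> Y \<and> bad \<omega>}"
    proof clarsimp
      fix \<omega> assume *: "\<omega> \<subseteq> E" "r \<notin> explore bs \<omega>" "r \<in> cl \<omega> b" "\<forall>k\<in>set post. r \<notin> cl \<omega> k"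
      have "explore (pre @ [b]) \<omega> \<subseteq> explore bs \<omega>"
        using explore_mono[of "pre @ [b]" \<omega> post] split by simp
      then have "r \<notin> explore (pre @ [b]) \<omega>" using * by blast
      then have "bad \<omega>" using * by (auto simp: bad_def explore_snoc explore_step_def split: if_splits)
      then show "\<omega> \<in> Y \<and> bad \<omega>" using * by (simp add: Y_def)
    qed
  qed (use finite_E W_pos in \<open>auto simp: less_imp_le\<close>)
  also have "\<dots> = (\<Sum>\<omega>\<in>Pow E. W \<omega> * of_bool (\<omega> \<in> Y \<and> bad \<omega>))"
    using finite_E by (intro sum.mono_neutral_cong_left) auto
  also have "\<dots> \<le> (\<Sum>\<omega>\<in>Pow E. W \<omega> * of_bool (bad \<omega>) * PY)"
  proof (rule sum_le_explore)
    fix \<omega> assume \<omega>: "\<omega> \<subseteq> E"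
    let ?C = "cylinder E (inc (explore pre \<omega>)) \<omega>"
    show "(\<Sum>\<omega>'\<in>?C. W \<omega>' * of_bool (\<omega>' \<in> Y \<and> bad \<omega>')) \<le> (\<Sum>\<omega>'\<in>?C. W \<omega>' * of_bool (bad \<omega>') * PY)"
    proof (cases "bad \<omega>")
      case True
      have "(\<Sum>\<omega>'\<in>?C. W \<omega>' * of_bool (\<omega>' \<in> Y \<and> bad \<omega>')) = (\<Sum>\<omega>'\<in>?C \<inter> Y. W \<omega>')"
        using bad_cyl[OF \<omega>] True finite_cylinder by (intro sum.mono_neutral_cong_right) auto
      also have "\<dots> \<le> (\<Sum>\<omega>'\<in>?C. W \<omega>') * PY"
        unfolding PY_def
      proof (rule cylinder_Int_le)
        fix \<omega>' \<zeta> assume \<omega>': "\<omega>' \<in> ?C \<inter> Y" and \<zeta>: "\<zeta> \<subseteq> inc (explore pre \<omega>)"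
        have eq: "explore pre \<omega>' = explore pre \<omega>" using explore_cylinder[OF \<omega>] \<omega>' by blast
        have "r \<notin> explore pre \<omega>'" using True eq by (simp add: bad_def)
        then show "\<zeta> \<union> (\<omega>' - inc (explore pre \<omega>)) \<in> Y"
          using resample_left[OF split, of \<omega>' \<zeta>] \<omega>' \<zeta> inc_subset unfolding eq Y_def by auto
      qed (use finite_E inc_subset p in \<open>auto simp: Y_def\<close>)
      also have "\<dots> = (\<Sum>\<omega>'\<in>?C. W \<omega>' * of_bool (bad \<omega>') * PY)"
        using bad_cyl[OF \<omega>] True by (simp add: sum_distrib_right cong: sum.cong)
      finally show ?thesis .
    next
      case False
      then show ?thesis using bad_cyl[OF \<omega>] by (simp cong: sum.cong)
    qed
  qed
  also have "\<dots> \<le> \<delta> * PY"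
  proof -
    have "(\<Sum>\<omega>\<in>Pow E. \<delta> * (W \<omega> * of_bool (bad \<omega>))) \<le> (\<Sum>\<omega>\<in>Pow E. W \<omega> * g b \<omega>)"
    proof (rule sum_le_explore)
      fix \<omega> assume \<omega>: "\<omega> \<subseteq> E"
      let ?C = "cylinder E (inc (explore pre \<omega>)) \<omega>"
      show "(\<Sum>\<omega>'\<in>?C. \<delta> * (W \<omega>' * of_bool (bad \<omega>'))) \<le> (\<Sum>\<omega>'\<in>?C. W \<omega>' * g b \<omega>')"
      proof (cases "bad \<omega>")
        case True
        then show ?thesis using bad_cyl[OF \<omega>]
          by (simp add: bad_def good_def sum_distrib_left cong: sum.cong)
      next
        case False
        have "0 \<le> (\<Sum>\<omega>'\<in>?C. W \<omega>' * g b \<omega>')"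
          using W_pos g_nonneg[OF b] by (intro sum_nonneg) (auto simp: cylinder_def less_imp_le)
        then show ?thesis using False bad_cyl[OF \<omega>] by (simp cong: sum.cong)
      qed
    qed
    also have "\<dots> \<le> \<delta>\<^sup>2" by (rule g_mean[OF b])
    finally have "\<delta> * (\<Sum>\<omega>\<in>Pow E. W \<omega> * of_bool (bad \<omega>)) \<le> \<delta> * \<delta>"
      by (simp add: sum_distrib_left power2_eq_square)
    then have "(\<Sum>\<omega>\<in>Pow E. W \<omega> * of_bool (bad \<omega>)) \<le> \<delta>" using \<delta> by simp
    then show ?thesis using PY by (simp add: mult_right_mono flip: sum_distrib_right)
  qed
  finally show ?thesis by (simp add: PY_def Y_def)
qed

text \<open>The failures are split according to the last target connected to \<open>r\<close>.\<close>

lemma failure_bound: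
  "(\<Sum>\<omega> | \<omega> \<subseteq> E \<and> r \<notin> explore bs \<omega> \<and> (\<exists>b\<in>set bs. r \<in> cl \<omega> b). W \<omega>)
    \<le> \<delta> * (\<Sum>\<omega> | \<omega> \<subseteq> E \<and> (\<exists>b\<in>set bs. r \<in> cl \<omega> b). W \<omega>)"
proof -
  have "(\<Sum>\<omega> | \<omega> \<subseteq> E \<and> r \<notin> explore bs \<omega> \<and> (\<exists>b\<in>set post. r \<in> cl \<omega> b). W \<omega>)
    \<le> \<delta> * (\<Sum>\<omega> | \<omega> \<subseteq> E \<and> (\<exists>b\<in>set post. r \<in> cl \<omega> b). W \<omega>)" if "bs = pre @ post" for pre post
    using that
  proof (induction post arbitrary: pre)
    case (Cons b post)
    have split: "{\<omega>. \<omega> \<subseteq> E \<and> Q \<omega> \<and> (\<exists>b\<in>set (b # post). r \<in> cl \<omega> b)} =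
      {\<omega>. \<omega> \<subseteq> E \<and> Q \<omega> \<and> r \<in> cl \<omega> b \<and> (\<forall>k\<in>set post. r \<notin> cl \<omega> k)} \<union>
      {\<omega>. \<omega> \<subseteq> E \<and> Q \<omega> \<and> (\<exists>b\<in>set post. r \<in> cl \<omega> b)}" for Q
      by auto
    have sum: "(\<Sum>\<omega> | \<omega> \<subseteq> E \<and> Q \<omega> \<and> (\<exists>b\<in>set (b # post). r \<in> cl \<omega> b). W \<omega>) =
      (\<Sum>\<omega> | \<omega> \<subseteq> E \<and> Q \<omega> \<and> r \<in> cl \<omega> b \<and> (\<forall>k\<in>set post. r \<notin> cl \<omega> k). W \<omega>) +
      (\<Sum>\<omega> | \<omega> \<subseteq> E \<and> Q \<omega> \<and> (\<exists>b\<in>set post. r \<in> cl \<omega> b). W \<omega>)" for Q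
      unfolding split using finite_E by (intro sum.union_disjoint) auto
    have "bs = (pre @ [b]) @ post" using Cons.prems by simp
    from Cons.IH[OF this] failure_step[OF Cons.prems]
    show ?case using sum[of "\<lambda>\<omega>. r \<notin> explore bs \<omega>"] sum[of "\<lambda>_. True"]
      by (simp add: distrib_left)
  qed simp
  from this[of "[]" bs] show ?thesis by simp
qed

text \<open>The successes are split according to the target at which \<open>r\<close> is found. The function \<open>h\<close> stands for the
  conditional probability that the event of some target connected to \<open>r\<close> occurs.\<close>

lemma success_bound:
  assumes h: "\<And>\<omega> b. \<omega> \<subseteq> E \<Longrightarrow> b \<in> set bs \<Longrightarrow> r \<in> cl \<omega> b \<Longrightarrow> 1 - g b \<omega> \<le> h \<omega>"
  shows "(1 - \<delta>) * (\<Sum>\<omega> | \<omega> \<subseteq> E \<and> r \<in> explore bs \<omega>. W \<omega>)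
    \<le> (\<Sum>\<omega> | \<omega> \<subseteq> E \<and> r \<in> explore bs \<omega>. W \<omega> * h \<omega>)"
proof -
  have "(1 - \<delta>) * (\<Sum>\<omega> | \<omega> \<subseteq> E \<and> r \<in> explore xs \<omega>. W \<omega>)
    \<le> (\<Sum>\<omega> | \<omega> \<subseteq> E \<and> r \<in> explore xs \<omega>. W \<omega> * h \<omega>)" if "set xs \<subseteq> set bs" for xs
    using that
  proof (induction xs rule: rev_induct)
    case (snoc b xs)
    let ?S = "{\<omega>. \<omega> \<subseteq> E \<and> r \<notin> explore xs \<omega> \<and> r \<in> explore (xs @ [b]) \<omega>}"
    have split: "{\<omega>. \<omega> \<subseteq> E \<and> r \<in> explore (xs @ [b]) \<omega>} = ?S \<union> {\<omega>. \<omega> \<subseteq> E \<and> r \<in> explore xs \<omega>}"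
      using explore_mono[of xs _ "[b]"] by auto
    have sum: "(\<Sum>\<omega> | \<omega> \<subseteq> E \<and> r \<in> explore (xs @ [b]) \<omega>. k \<omega>)
        = (\<Sum>\<omega>\<in>?S. k \<omega>) + (\<Sum>\<omega> | \<omega> \<subseteq> E \<and> r \<in> explore xs \<omega>. k \<omega>)" for k :: "'e set \<Rightarrow> real"
      unfolding split using finite_E by (intro sum.union_disjoint) auto
    have b: "b \<in> set bs" using snoc.prems by simp
    have "(1 - \<delta>) * (\<Sum>\<omega>\<in>?S. W \<omega>) \<le> (\<Sum>\<omega>\<in>?S. W \<omega> * (1 - g b \<omega>))"
      using success_step[OF b, of xs] by (simp add: algebra_simps sum_subtractf)
    also have "\<dots> \<le> (\<Sum>\<omega>\<in>?S. W \<omega> * h \<omega>)"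
      using h[OF _ b] W_pos
      by (intro sum_mono mult_left_mono) (auto simp: explore_snoc explore_step_def less_imp_le split: if_splits)
    finally show ?case
      using snoc unfolding sum by (simp add: distrib_left)
  qed simp
  then show ?thesis by blast
qed

theorem exploration_bound:
  assumes h: "\<And>\<omega> b. \<omega> \<subseteq> E \<Longrightarrow> b \<in> set bs \<Longrightarrow> r \<in> cl \<omega> b \<Longrightarrow> 1 - g b \<omega> \<le> h \<omega>"
    and h_nonneg: "\<And>\<omega>. \<omega> \<subseteq> E \<Longrightarrow> 0 \<le> h \<omega>" and "\<delta> \<le> 1"
  shows "(1 - 2 * \<delta>) * (\<Sum>\<omega> | \<omega> \<subseteq> E \<and> (\<exists>b\<in>set bs. r \<in> cl \<omega> b). W \<omega>)
    \<le> (\<Sum>\<omega> | \<omega> \<subseteq> E \<and> (\<exists>b\<in>set bs. r \<in> cl \<omega> b). W \<omega> * h \<omega>)"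
proof -
  let ?conn = "{\<omega>. \<omega> \<subseteq> E \<and> (\<exists>b\<in>set bs. r \<in> cl \<omega> b)}"
  let ?fail = "{\<omega>. \<omega> \<subseteq> E \<and> r \<notin> explore bs \<omega> \<and> (\<exists>b\<in>set bs. r \<in> cl \<omega> b)}"
  let ?succ = "{\<omega>. \<omega> \<subseteq> E \<and> r \<in> explore bs \<omega>}"
  have conn: "?conn = ?succ \<union> ?fail"
    using explore_is_union_of_clusters by blast
  have "sum W ?conn = sum W ?succ + sum W ?fail"
    unfolding conn using finite_E by (intro sum.union_disjoint) auto
  then have *: "(1 - \<delta>) * sum W ?conn \<le> sum W ?succ"
    using failure_bound by (simp add: algebra_simps)
  have "0 \<le> \<delta>\<^sup>2 * sum W ?conn"
    using W_pos by (intro mult_nonneg_nonneg sum_nonneg) (auto simp: less_imp_le)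
  then have "(1 - 2 * \<delta>) * sum W ?conn \<le> (1 - \<delta>) * ((1 - \<delta>) * sum W ?conn)"
    by (simp add: algebra_simps power2_eq_square)
  also have "\<dots> \<le> (1 - \<delta>) * sum W ?succ"
    using * \<open>\<delta> \<le> 1\<close> by (intro mult_left_mono) auto
  also have "\<dots> \<le> (\<Sum>\<omega>\<in>?succ. W \<omega> * h \<omega>)"
    by (rule success_bound[OF h])
  also have "\<dots> \<le> (\<Sum>\<omega>\<in>?conn. W \<omega> * h \<omega>)"
    unfolding conn using finite_E h_nonneg W_pos by (intro sum_mono2) (auto simp: less_imp_le)
  finally show ?thesis .
qed

end

section \<open>Disjoint arcs through the outer face\<close>

text \<open>The fashoda theorem for paths above a horizontal line, carried over from the Cartesian plane.\<close>

lemma complex_paths_interlace: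
  fixes f g :: "real \<Rightarrow> complex"
  assumes "path f" "path g"
    and above: "path_image f \<union> path_image g \<subseteq> {z. c \<le> Im z}"
    and Im: "Im (pathstart f) = c" "Im (pathfinish f) = c" "Im (pathstart g) = c" "Im (pathfinish g) = c"
    and Re: "Re (pathstart f) < Re (pathstart g)" "Re (pathstart g) < Re (pathfinish f)"
      "Re (pathfinish f) < Re (pathfinish g)"
  shows "path_image f \<inter> path_image g \<noteq> {}"
proof -
  define h :: "complex \<Rightarrow> real^2" where "h z = (\<chi> i. if i = 1 then Re z else Im z)" for z
  have h: "h z $ 1 = Re z" "h z $ 2 = Im z" for z by (simp_all add: h_def)
  have cont: "continuous_on S h" for S
    unfolding h_def
  proof (rule continuous_on_vec_lambda)
    fix i :: 2
    show "continuous_on S (\<lambda>z. if i = 1 then Re z else Im z)"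
      by (cases "i = 1") (auto intro!: continuous_intros)
  qed
  have "bounded (path_image f \<union> path_image g)"
    using assms by (simp add: bounded_path_image)
  then obtain N where N: "\<And>z. z \<in> path_image f \<union> path_image g \<Longrightarrow> norm z \<le> N"
    by (auto simp: bounded_iff)
  define a b :: "real^2" where "a = (\<chi> i. if i = 1 then - N else c)" and "b = (\<chi> i. N)"
  have a: "a $ 1 = - N" "a $ 2 = c" by (simp_all add: a_def)
  have box: "h z \<in> cbox a b" if "z \<in> path_image f \<union> path_image g" for z
  proof -
    have "c \<le> Im z" using that above by blast
    then show ?thesis
      using N[OF that] abs_Re_le_cmod[of z] abs_Im_le_cmod[of z]
      by (auto simp: mem_box_cart forall_2 h a b_def)
  qed
  obtain w where "w \<in> path_image (h \<circ> f)" "w \<in> path_image (h \<circ> g)"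
  proof (rule fashoda_interlace[of "h \<circ> f" "h \<circ> g" a b])
    show "path (h \<circ> f)" "path (h \<circ> g)" using assms cont by (auto intro: path_continuous_image)
    show "path_image (h \<circ> f) \<subseteq> cbox a b" "path_image (h \<circ> g) \<subseteq> cbox a b"
      using box by (auto simp: path_image_compose)
  qed (use Im Re in \<open>simp_all add: pathstart_compose pathfinish_compose h a\<close>)
  then obtain x y where "x \<in> path_image f" "y \<in> path_image g" "h x = h y"
    by (auto simp: path_image_compose)
  moreover from this have "x = y" using h by (metis complex_eqI)
  ultimately show ?thesis by blast
qed

text \<open>A fan consists of disjoint legs from \<open>K\<close> down to the line of height \<open>c\<close>. A leg starts somewhere in the
  neighbourhood \<open>N t\<close> and not at a prescribed point: a boundary point of the outer face is only known
  to be a limit of accessible points, and this suffices.\<close>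

definition fan :: "complex set \<Rightarrow> real \<Rightarrow> ('v \<Rightarrow> complex set) \<Rightarrow> 'v set \<Rightarrow> ('v \<Rightarrow> real \<Rightarrow> complex) \<Rightarrow> bool" where
  "fan K c N T \<alpha> \<longleftrightarrow>
     (\<forall>t\<in>T. arc (\<alpha> t) \<and> pathstart (\<alpha> t) \<in> N t \<and> path_image (\<alpha> t) \<inter> K = {pathstart (\<alpha> t)} \<and>
        Im (pathfinish (\<alpha> t)) = c \<and> path_image (\<alpha> t) \<subseteq> {z. c \<le> Im z}) \<and>
     (\<forall>s\<in>T. \<forall>t\<in>T. s \<noteq> t \<longrightarrow> path_image (\<alpha> s) \<inter> path_image (\<alpha> t) = {})"

lemma fanD:
  assumes "fan K c N T \<alpha>" "t \<in> T"
  shows "arc (\<alpha> t)" "pathstart (\<alpha> t) \<in> N t" "path_image (\<alpha> t) \<inter> K = {pathstart (\<alpha> t)}"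
    "Im (pathfinish (\<alpha> t)) = c" "path_image (\<alpha> t) \<subseteq> {z. c \<le> Im z}"
  using assms unfolding fan_def by simp_all

lemma fan_disjoint:
  "fan K c N T \<alpha> \<Longrightarrow> s \<in> T \<Longrightarrow> t \<in> T \<Longrightarrow> s \<noteq> t \<Longrightarrow> path_image (\<alpha> s) \<inter> path_image (\<alpha> t) = {}"
  unfolding fan_def by simp

text \<open>The part of \<open>g\<close> after its last visit to the closed half-plane below the line, reversed.\<close>

lemma arc_down_to_line:
  fixes g :: "real \<Rightarrow> complex"
  assumes "arc g" "Im (pathstart g) \<le> c" "c < Im (pathfinish g)"
  obtains \<alpha> where "arc \<alpha>" "pathstart \<alpha> = pathfinish g" "Im (pathfinish \<alpha>) = c"
    "path_image \<alpha> \<subseteq> {z. c \<le> Im z}" "path_image \<alpha> \<subseteq> insert (pathfinish g) (g ` {0..<1})"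
proof -
  have cont: "continuous_on {0..1} (\<lambda>s. Im (g s))"
    using \<open>arc g\<close> by (intro continuous_intros) (simp add: arc_def path_def)
  define Q where "Q = {s \<in> {0..1}. Im (g s) \<le> c}"
  have Q_alt: "Q = {s \<in> {0..1}. Im (g s) \<in> {..c}}" by (auto simp: Q_def)
  have "closed Q" unfolding Q_alt
    using continuous_closed_preimage[OF cont, of "{..c}"] by (simp add: vimage_def Int_def)
  moreover have "bounded Q" by (rule bounded_subset[of "{0..1}"]) (auto simp: Q_def)
  ultimately have "compact Q" by (simp add: compact_eq_bounded_closed)
  moreover have "0 \<in> Q" using assms by (simp add: Q_def pathstart_def)
  ultimately obtain s where s: "s \<in> Q" "\<And>t. t \<in> Q \<Longrightarrow> t \<le> s"
    using compact_attains_sup[of Q] by blast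
  have s01: "0 \<le> s" "s < 1"
    using s assms by (auto simp: Q_def pathfinish_def order_less_le)
  have "\<exists>x\<ge>s. x \<le> 1 \<and> Im (g x) = c"
    using s s01 assms
    by (intro IVT') (auto simp: Q_def pathfinish_def intro: continuous_on_subset[OF cont])
  then obtain x where "s \<le> x" "x \<le> 1" "Im (g x) = c" by blast
  moreover from this have "x = s" using s(2)[of x] s01 by (simp add: Q_def)
  ultimately have Ims: "Im (g s) = c" by simp
  have img: "path_image (subpath 1 s g) = g ` {s..1}"
    using s01 by (simp add: path_image_subpath)
  show ?thesis
  proof (rule that)
    show "arc (subpath 1 s g)" using s01 assms by (intro arc_subpath_arc) auto
    show "pathstart (subpath 1 s g) = pathfinish g" by (simp add: pathfinish_def)
    show "Im (pathfinish (subpath 1 s g)) = c" using Ims by simp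
    show "path_image (subpath 1 s g) \<subseteq> {z. c \<le> Im z}"
    proof -
      have "c \<le> Im (g t)" if "s \<le> t" "t \<le> 1" for t
      proof (rule ccontr)
        assume *: "\<not> c \<le> Im (g t)"
        then have "t \<in> Q" using that s01 by (simp add: Q_def)
        then have "t = s" using s that by force
        then show False using * Ims by simp
      qed
      then show ?thesis unfolding img by auto
    qed
    show "path_image (subpath 1 s g) \<subseteq> insert (pathfinish g) (g ` {0..<1})"
      unfolding img using s01 by (auto simp: pathfinish_def image_iff order_less_le)
  qed
qed

text \<open>Neither \<open>K \<union> U\<close> nor an arc separates the points in question, and they meet in a single point, so by
  Janiszewski's theorem their union does not separate either.\<close>

lemma connected_outside_minus_arc:
  fixes K U :: "complex set"
  assumes "compact K" "compact U" "connected (outside K - U)" "arc \<alpha>"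
    and "(K \<union> U) \<inter> path_image \<alpha> = {x}"
  shows "connected (outside K - (U \<union> path_image \<alpha>))"
proof (unfold connected_iff_connected_component, intro ballI)
  fix a b assume ab: "a \<in> outside K - (U \<union> path_image \<alpha>)" "b \<in> outside K - (U \<union> path_image \<alpha>)"
  have "connected_component (- ((K \<union> U) \<union> path_image \<alpha>)) a b"
  proof (rule Janiszewski)
    have "outside K - U \<subseteq> - (K \<union> U)" using outside_no_overlap by fastforce
    then show "connected_component (- (K \<union> U)) a b"
      using assms(3) ab unfolding connected_component_def by blast
    show "connected_component (- path_image \<alpha>) a b"
      using connected_arc_complement[OF \<open>arc \<alpha>\<close>] ab unfolding connected_component_def by auto
  qed (use assms in \<open>auto simp: closed_arc_image\<close>)
  then obtain X where X: "connected X" "X \<subseteq> - ((K \<union> U) \<union> path_image \<alpha>)" "a \<in> X" "b \<in> X"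
    unfolding connected_component_def by blast
  have "X \<subseteq> outside K"
  proof
    fix y assume "y \<in> X"
    then have "connected_component (- K) a y"
      using X unfolding connected_component_def by blast
    then show "y \<in> outside K" using ab outside_same_component by blast
  qed
  then show "connected_component (outside K - (U \<union> path_image \<alpha>)) a b"
    using X unfolding connected_component_def by blast
qed

text \<open>The legs are added one at a time. Each leg touches the previous compact set in one point only, so
  the rest of the outer face stays connected, still contains the points below the line, and still
  has the remaining \<open>z t\<close> on its frontier. An accessible frontier point close to \<open>z t\<close> is then
  joined by an arc to a point below the line, and the arc is cut where it last leaves
  the half-plane below the line.\<close>

lemma exists_fan:
  fixes K :: "complex set"
  assumes "compact K" "K \<subseteq> {z. c < Im z}" "finite T"
    and front: "\<And>t. t \<in> T \<Longrightarrow> z t \<in> frontier (outside K)"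
    and near: "\<And>t. t \<in> T \<Longrightarrow> \<exists>d>0. ball (z t) d \<inter> K \<subseteq> N t"
    and disj: "\<And>s t. s \<in> T \<Longrightarrow> t \<in> T \<Longrightarrow> s \<noteq> t \<Longrightarrow> N s \<inter> N t = {}"
  shows "\<exists>\<alpha>. fan K c N T \<alpha>"
proof -
  have "closed K" "bounded K" using \<open>compact K\<close> by (auto simp: compact_imp_closed compact_imp_bounded)
  then have op: "open (outside K)" and frontK: "frontier (outside K) \<subseteq> K"
    by (auto simp: open_outside frontier_outside_subset)
  have "\<exists>\<alpha>. fan K c N T' \<alpha> \<and> connected (outside K - (\<Union>t\<in>T'. path_image (\<alpha> t)))" if "T' \<subseteq> T" for T'
    using finite_subset[OF that \<open>finite T\<close>] that
  proof (induction T')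
    case empty
    then show ?case using \<open>bounded K\<close> by (simp add: fan_def connected_outside)
  next
    case (insert t T')
    then obtain \<alpha> where \<alpha>: "fan K c N T' \<alpha>" and conn: "connected (outside K - (\<Union>t\<in>T'. path_image (\<alpha> t)))"
      by auto
    define U where "U = (\<Union>t\<in>T'. path_image (\<alpha> t))"
    have "t \<in> T" using insert.prems by simp
    have "compact U" unfolding U_def using insert.hyps fanD(1)[OF \<alpha>] by (intro compact_UN) (auto simp: compact_arc_image)
    then have "closed U" by (rule compact_imp_closed)
    obtain d where d: "0 < d" "ball (z t) d \<inter> K \<subseteq> N t" using near[OF \<open>t \<in> T\<close>] by blast
    have zt: "z t \<in> frontier (outside K)" "z t \<in> K" using front[OF \<open>t \<in> T\<close>] frontK by auto
    have "z t \<in> N t" using d zt by auto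
    have "z t \<notin> U"
    proof
      assume "z t \<in> U"
      then obtain s where s: "s \<in> T'" "z t \<in> path_image (\<alpha> s)" by (auto simp: U_def)
      then have "z t = pathstart (\<alpha> s)" using fanD(3)[OF \<alpha> s(1)] zt(2) by blast
      then have "z t \<in> N s" using fanD(2)[OF \<alpha> s(1)] by simp
      moreover have "s \<in> T" "s \<noteq> t" using s(1) insert.hyps insert.prems by auto
      ultimately show False using \<open>z t \<in> N t\<close> disj[of s t] \<open>t \<in> T\<close> by blast
    qed
    then obtain d' where d': "0 < d'" "ball (z t) d' \<subseteq> - U"
      using \<open>closed U\<close> open_contains_ball[of "- U"] by auto
    let ?O = "outside K - U"
    let ?V = "frontier ?O \<inter> ball (z t) (min d d')"
    have opO: "open ?O" using op \<open>closed U\<close> by (rule open_Diff)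
    have "z t \<in> closure ?O"
    proof -
      have "z t \<in> - U \<inter> closure (outside K)" using \<open>z t \<notin> U\<close> zt by (simp add: frontier_def)
      then show ?thesis
        using open_Int_closure_subset[of "- U" "outside K"] \<open>closed U\<close> by (auto simp: Diff_eq Int_commute)
    qed
    moreover have "z t \<notin> ?O" using zt outside_no_overlap by fastforce
    ultimately have "z t \<in> ?V" using d d' opO by (simp add: frontier_def interior_open)
    have below: "Complex 0 (c - 1) \<in> ?O"
    proof -
      have "Complex 0 (c - 1) \<in> outside {z. c < Im z}"
        by (intro convex_in_outside) (auto simp: convex_halfspace_Im_gt)
      then have "Complex 0 (c - 1) \<in> outside K" using outside_mono assms(2) by blast
      moreover have "Complex 0 (c - 1) \<notin> U" using fanD(5)[OF \<alpha>] by (force simp: U_def)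
      ultimately show ?thesis by simp
    qed
    obtain g where g: "arc g" "g ` {0..<1} \<subseteq> ?O" "pathstart g = Complex 0 (c - 1)" "pathfinish g \<in> ?V"
    proof (rule dense_accessible_frontier_points_connected[of ?O "Complex 0 (c - 1)" ?V])
      show "openin (top_of_set (frontier ?O)) ?V" by (simp add: openin_open_Int)
    qed (use opO conn below \<open>z t \<in> ?V\<close> in \<open>auto simp: U_def\<close>)
    let ?x = "pathfinish g"
    have xU: "?x \<notin> U" using g d' by auto
    have "?x \<in> frontier (outside K)"
    proof -
      have "?x \<in> closure (outside K)"
        using g closure_mono[of ?O "outside K"] by (auto simp: frontier_def)
      moreover have "?x \<notin> outside K"
        using g opO xU by (auto simp: frontier_def interior_open)
      ultimately show ?thesis using op by (simp add: frontier_def interior_open)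
    qed
    then have "?x \<in> K" using frontK by blast
    then have xN: "?x \<in> N t" using g d by auto
    obtain \<beta> where \<beta>: "arc \<beta>" "pathstart \<beta> = ?x" "Im (pathfinish \<beta>) = c"
      "path_image \<beta> \<subseteq> {z. c \<le> Im z}" "path_image \<beta> \<subseteq> insert ?x (g ` {0..<1})"
    proof (rule arc_down_to_line)
      show "Im (pathstart g) \<le> c" "c < Im ?x" using g(3) \<open>?x \<in> K\<close> assms(2) by auto
    qed (use g in auto)
    have xb: "?x \<in> path_image \<beta>" using \<beta>(2) pathstart_in_path_image by metis
    have \<beta>K: "path_image \<beta> \<inter> K = {?x}"
      using \<beta>(5) g(2) \<open>?x \<in> K\<close> xb outside_no_overlap[of K] by blast
    have \<beta>U: "path_image \<beta> \<inter> U = {}" using \<beta>(5) g(2) xU by blast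
    let ?\<alpha> = "\<alpha>(t := \<beta>)"
    have same: "?\<alpha> s = \<alpha> s" if "s \<in> T'" for s using that insert.hyps by auto
    have "fan K c N (insert t T') ?\<alpha>"
      unfolding fan_def
    proof (intro conjI ballI impI)
      fix s assume "s \<in> insert t T'"
      then consider "s = t" | "s \<in> T'" "s \<noteq> t" using insert.hyps by blast
      then show "arc (?\<alpha> s)" "pathstart (?\<alpha> s) \<in> N s" "path_image (?\<alpha> s) \<inter> K = {pathstart (?\<alpha> s)}"
        "Im (pathfinish (?\<alpha> s)) = c" "path_image (?\<alpha> s) \<subseteq> {z. c \<le> Im z}"
        using fanD[OF \<alpha>, of s] \<beta> \<beta>K xN by (cases; simp)+
    next
      fix s s' assume *: "s \<in> insert t T'" "s' \<in> insert t T'" "s \<noteq> s'"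
      have "path_image \<beta> \<inter> path_image (\<alpha> s) = {}" if "s \<in> T'" for s
        using \<beta>U that by (auto simp: U_def)
      then show "path_image (?\<alpha> s) \<inter> path_image (?\<alpha> s') = {}"
        using * fan_disjoint[OF \<alpha>, of s s'] by (cases "s = t"; cases "s' = t") (auto simp: Int_commute)
    qed
    moreover have "(\<Union>s\<in>insert t T'. path_image (?\<alpha> s)) = U \<union> path_image \<beta>"
      using same by (auto simp: U_def)
    moreover have "connected (outside K - (U \<union> path_image \<beta>))"
      using \<beta>(1) \<beta>K \<beta>U \<open>compact K\<close> \<open>compact U\<close> conn
      by (intro connected_outside_minus_arc[of _ _ _ ?x]) (auto simp: U_def)
    ultimately show ?case by metis
  qed
  then show ?thesis by blast
qed

section \<open>The order of the targets around the outer face\<close>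

locale plane_graph =
  fixes V :: "'v set" and E :: "'e set" and ends :: "'e \<Rightarrow> 'v set"
    and \<phi> :: "'v \<Rightarrow> complex" and \<gamma> :: "'e \<Rightarrow> real \<Rightarrow> complex"
  assumes graph: "finite_loopless_multigraph V E ends"
    and embedding: "planar_embedding V E ends \<phi> \<gamma>"
begin

lemma finite_V: "finite V" and finite_E: "finite E"
  and ends_subset: "e \<in> E \<Longrightarrow> ends e \<subseteq> V" and card_ends: "e \<in> E \<Longrightarrow> card (ends e) = 2"
  using graph by (auto simp: finite_loopless_multigraph_def)

lemma inj_\<phi>: "inj_on \<phi> V" and arc_\<gamma>: "e \<in> E \<Longrightarrow> arc (\<gamma> e)"
  and \<gamma>_ends: "e \<in> E \<Longrightarrow> {\<gamma> e 0, \<gamma> e 1} = \<phi> ` ends e"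
  and \<gamma>_interior: "e \<in> E \<Longrightarrow> 0 < t \<Longrightarrow> t < 1 \<Longrightarrow> \<gamma> e t \<notin> \<phi> ` V"
proof -
  show "inj_on \<phi> V" "e \<in> E \<Longrightarrow> arc (\<gamma> e)" "e \<in> E \<Longrightarrow> {\<gamma> e 0, \<gamma> e 1} = \<phi> ` ends e"
    using embedding by (simp_all add: planar_embedding_def pathstart_def pathfinish_def)
  assume "e \<in> E" "0 < t" "t < 1"
  then have "\<gamma> e t \<in> \<gamma> e ` {0<..<1}" "\<gamma> e ` {0<..<1} \<inter> \<phi> ` V = {}"
    using embedding by (simp_all add: planar_embedding_def)
  then show "\<gamma> e t \<notin> \<phi> ` V" by blast
qed

lemma \<gamma>_interior_neq: "e \<in> E \<Longrightarrow> 0 < t \<Longrightarrow> t < 1 \<Longrightarrow> v \<in> V \<Longrightarrow> \<gamma> e t \<noteq> \<phi> v"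
  using \<gamma>_interior by (metis imageI)

lemma \<gamma>_interior_unique:
  assumes "e \<in> E" "f \<in> E" "0 < s" "s < 1" "0 \<le> t" "t \<le> 1" "\<gamma> e s = \<gamma> f t"
  shows "e = f \<and> s = t"
proof -
  have "\<gamma> f t \<notin> \<phi> ` V" using \<gamma>_interior assms by metis
  moreover have "\<gamma> f 0 \<in> \<phi> ` V" "\<gamma> f 1 \<in> \<phi> ` V" using \<gamma>_ends ends_subset \<open>f \<in> E\<close> by blast+
  ultimately have t: "0 < t" "t < 1" using assms by (metis order_less_le)+
  have "e = f"
  proof (rule ccontr)
    assume "e \<noteq> f"
    then have "\<gamma> e ` {0<..<1} \<inter> \<gamma> f ` {0<..<1} = {}"
      using embedding assms by (auto simp: planar_embedding_def)
    moreover have "\<gamma> e s \<in> \<gamma> e ` {0<..<1}" "\<gamma> e s \<in> \<gamma> f ` {0<..<1}"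
      using assms(3,4) by simp (simp add: assms(7) t)
    ultimately show False by blast
  qed
  then show ?thesis using arc_\<gamma>[OF \<open>e \<in> E\<close>] assms by (auto simp: arc_def dest: inj_onD)
qed

text \<open>The vertex with a third of each incident edge. Only points with \<open>0 < t < 1\<close> are listed, so that no
  point except \<open>\<phi> v\<close> is the image of a vertex; thirds instead of halves keep the two ends of an edge apart.\<close>

definition star :: "'v \<Rightarrow> complex set" where
  "star v = insert (\<phi> v) {\<gamma> e t | e t. e \<in> E \<and> 0 < t \<and> t < 1 \<and>
     (\<gamma> e 0 = \<phi> v \<and> t \<le> 1 / 3 \<or> \<gamma> e 1 = \<phi> v \<and> 2 / 3 \<le> t)}"

lemma star_center: "\<phi> v \<in> star v"
  by (simp add: star_def)

lemma star_edgeI: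
  "e \<in> E \<Longrightarrow> 0 < t \<Longrightarrow> t < 1 \<Longrightarrow>
    \<gamma> e 0 = \<phi> v \<and> t \<le> 1 / 3 \<or> \<gamma> e 1 = \<phi> v \<and> 2 / 3 \<le> t \<Longrightarrow> \<gamma> e t \<in> star v"
  unfolding star_def by blast

text \<open>The part of the drawing that belongs to the subgraph induced by \<open>S\<close>, enlarged by the stars of its
  vertices so that it contains the starting points of the legs at \<open>S\<close>.\<close>

definition region :: "'v set \<Rightarrow> complex set" where
  "region S = (\<Union>v\<in>S. star v) \<union> (\<Union>e\<in>{e \<in> E. ends e \<subseteq> S}. path_image (\<gamma> e))"

lemma edge_point_cases:
  assumes "e \<in> E" "x \<in> path_image (\<gamma> e)"
  obtains "x \<in> \<phi> ` ends e" | t where "0 < t" "t < 1" "x = \<gamma> e t"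
proof -
  obtain t where t: "0 \<le> t" "t \<le> 1" "x = \<gamma> e t" using assms by (auto simp: path_image_def)
  show ?thesis
  proof (cases "t = 0 \<or> t = 1")
    case True
    then show ?thesis using t that(1) \<gamma>_ends[OF \<open>e \<in> E\<close>] by blast
  next
    case False
    then have "0 < t" "t < 1" using t by auto
    then show ?thesis using t(3) that(2) by blast
  qed
qed

lemma drawing_cases:
  assumes "x \<in> drawing V E \<phi> \<gamma>"
  obtains v where "v \<in> V" "x = \<phi> v" | e t where "e \<in> E" "0 < t" "t < 1" "x = \<gamma> e t"
proof -
  consider "x \<in> \<phi> ` V" | e where "e \<in> E" "x \<in> path_image (\<gamma> e)"
    using assms by (auto simp: drawing_def)
  then show ?thesis
  proof cases
    case 1
    then show ?thesis using that(1) by blast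
  next
    case (2 e)
    then show ?thesis
    proof (cases rule: edge_point_cases)
      case 1
      then show ?thesis using that(1) ends_subset[OF 2(1)] by blast
    next
      case (2 t)
      then show ?thesis using that(2) \<open>e \<in> E\<close> by blast
    qed
  qed
qed

lemma endpoint_in_ends:
  assumes "e \<in> E" "v \<in> V" "\<gamma> e 0 = \<phi> v \<or> \<gamma> e 1 = \<phi> v"
  shows "v \<in> ends e"
proof -
  have "\<phi> v \<in> {\<gamma> e 0, \<gamma> e 1}" using assms(3) by auto
  then show ?thesis
    using inj_on_image_mem_iff[OF inj_\<phi> \<open>v \<in> V\<close> ends_subset[OF \<open>e \<in> E\<close>]] \<gamma>_ends[OF \<open>e \<in> E\<close>] by simp
qed

lemma star_cases:
  assumes "x \<in> star v"
  obtains "x = \<phi> v"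
  | e t where "e \<in> E" "0 < t" "t < 1" "x = \<gamma> e t" "\<gamma> e 0 = \<phi> v" "t \<le> 1 / 3"
  | e t where "e \<in> E" "0 < t" "t < 1" "x = \<gamma> e t" "\<gamma> e 1 = \<phi> v" "2 / 3 \<le> t"
  using assms by (auto simp: star_def)

lemma star_vertex:
  assumes "u \<in> V" "v \<in> V" "\<phi> u \<in> star v"
  shows "u = v"
proof -
  have "\<phi> u \<noteq> \<gamma> e t" if "e \<in> E" "0 < t" "t < 1" for e t
    using \<gamma>_interior_neq[OF that \<open>u \<in> V\<close>] by simp
  with assms(3) have "\<phi> u = \<phi> v" by (cases rule: star_cases) blast+
  then show ?thesis using assms(1,2) by (rule inj_onD[OF inj_\<phi>])
qed

lemma star_disjoint:
  assumes "u \<in> V" "v \<in> V" "u \<noteq> v"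
  shows "star u \<inter> star v = {}"
proof (rule ccontr)
  assume "star u \<inter> star v \<noteq> {}"
  then obtain x where x: "x \<in> star u" "x \<in> star v" by blast
  have "x \<noteq> \<phi> u" "x \<noteq> \<phi> v" using x star_vertex assms by blast+
  then obtain e s f t where e: "e \<in> E" "0 < s" "s < 1" "x = \<gamma> e s"
      "\<gamma> e 0 = \<phi> u \<and> s \<le> 1 / 3 \<or> \<gamma> e 1 = \<phi> u \<and> 2 / 3 \<le> s"
    and f: "f \<in> E" "0 < t" "t < 1" "x = \<gamma> f t"
      "\<gamma> f 0 = \<phi> v \<and> t \<le> 1 / 3 \<or> \<gamma> f 1 = \<phi> v \<and> 2 / 3 \<le> t"
    using x unfolding star_def by blast
  then have "e = f" "s = t" using \<gamma>_interior_unique[of e f s t] by auto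
  then have "\<phi> u = \<phi> v" using e(5) f(5) by auto
  then have "u = v" using inj_onD[OF inj_\<phi>] assms(1,2) by blast
  then show False using assms(3) by contradiction
qed

lemma star_edge_disjoint:
  assumes "e \<in> E" "v \<in> V" "v \<notin> ends e"
  shows "star v \<inter> path_image (\<gamma> e) = {}"
proof (rule ccontr)
  assume "star v \<inter> path_image (\<gamma> e) \<noteq> {}"
  then obtain x where x: "x \<in> star v" "x \<in> path_image (\<gamma> e)" by blast
  from \<open>e \<in> E\<close> x(2) show False
  proof (cases rule: edge_point_cases)
    case 1
    then obtain u where "u \<in> ends e" "x = \<phi> u" by blast
    then show False using star_vertex x assms ends_subset by blast
  next
    case (2 t)
    then have "x \<noteq> \<phi> v" using \<gamma>_interior_neq assms by simp
    then obtain f s where f: "f \<in> E" "0 < s" "s < 1" "x = \<gamma> f s" "\<gamma> f 0 = \<phi> v \<or> \<gamma> f 1 = \<phi> v"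
      using x unfolding star_def by blast
    then have "e = f" using \<gamma>_interior_unique[of e f t s] 2 assms by auto
    then show False using f endpoint_in_ends assms by blast
  qed
qed

lemma edges_disjoint:
  assumes "e \<in> E" "f \<in> E" "ends e \<inter> ends f = {}"
  shows "path_image (\<gamma> e) \<inter> path_image (\<gamma> f) = {}"
proof (rule ccontr)
  assume "path_image (\<gamma> e) \<inter> path_image (\<gamma> f) \<noteq> {}"
  then obtain x where x: "x \<in> path_image (\<gamma> e)" "x \<in> path_image (\<gamma> f)" by blast
  have "e \<noteq> f" using assms card_ends[of e] by auto
  from \<open>e \<in> E\<close> x(1) show False
  proof (cases rule: edge_point_cases)
    case 1
    then obtain u where "u \<in> ends e" "x = \<phi> u" by blast
    moreover have "\<phi> u \<in> star u" by (simp add: star_def)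
    ultimately show False using star_edge_disjoint[of f u] x assms ends_subset by blast
  next
    case (2 s)
    obtain t where "0 \<le> t" "t \<le> 1" "x = \<gamma> f t" using x by (auto simp: path_image_def)
    then show False using \<gamma>_interior_unique[of e f s t] 2 assms \<open>e \<noteq> f\<close> by auto
  qed
qed

lemma region_cases:
  assumes "x \<in> region S"
  obtains u where "u \<in> S" "x \<in> star u" | e where "e \<in> E" "ends e \<subseteq> S" "x \<in> path_image (\<gamma> e)"
  using assms by (auto simp: region_def)

lemma region_disjoint:
  assumes "S \<subseteq> V" "S' \<subseteq> V" "S \<inter> S' = {}"
  shows "region S \<inter> region S' = {}"
proof -
  have vv: "star u \<inter> star v = {}" if "u \<in> S" "v \<in> S'" for u v
    using that assms by (intro star_disjoint) auto
  have ve: "star u \<inter> path_image (\<gamma> e) = {}" if "u \<in> S" "e \<in> E" "ends e \<subseteq> S'" for u e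
    using that assms by (intro star_edge_disjoint) auto
  have ev: "star u \<inter> path_image (\<gamma> e) = {}" if "u \<in> S'" "e \<in> E" "ends e \<subseteq> S" for u e
    using that assms by (intro star_edge_disjoint) auto
  have ee: "path_image (\<gamma> e) \<inter> path_image (\<gamma> f) = {}"
    if "e \<in> E" "f \<in> E" "ends e \<subseteq> S" "ends f \<subseteq> S'" for e f
    using that assms by (intro edges_disjoint) auto
  have False if "x \<in> region S" "x \<in> region S'" for x
    using that(1)
  proof (cases rule: region_cases)
    case (1 u)
    from that(2) show ?thesis
      by (cases rule: region_cases) (use 1 vv ve in \<open>meson disjoint_iff\<close>)+
  next
    case (2 e)
    from that(2) show ?thesis
      by (cases rule: region_cases) (use 2 ev ee in \<open>meson disjoint_iff\<close>)+
  qed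
  then show ?thesis by blast
qed

lemma star_subset_region: "v \<in> S \<Longrightarrow> star v \<subseteq> region S"
  by (auto simp: region_def)

lemma region_subset_drawing:
  assumes "S \<subseteq> V"
  shows "region S \<subseteq> drawing V E \<phi> \<gamma>"
proof -
  have "star v \<subseteq> drawing V E \<phi> \<gamma>" if "v \<in> S" for v
    using that assms unfolding star_def drawing_def path_image_def by fastforce
  then show ?thesis using assms unfolding region_def by (auto simp: drawing_def)
qed

lemma compact_drawing: "compact (drawing V E \<phi> \<gamma>)"
  unfolding drawing_def using finite_V finite_E arc_\<gamma>
  by (intro compact_Un compact_UN finite_imp_compact[of "\<phi> ` V"]) (auto simp: compact_arc_image)

text \<open>The points of the drawing outside the star of \<open>v\<close> lie in a compact set \<open>Z\<close> that does not contain \<open>\<phi> v\<close>: the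
  other vertices and, on each edge, the parameters at distance at least a third from each end at \<open>v\<close>.\<close>

lemma drawing_near_vertex:
  assumes "v \<in> V"
  shows "\<exists>d>0. ball (\<phi> v) d \<inter> drawing V E \<phi> \<gamma> \<subseteq> star v"
proof -
  define I where "I e = (if \<gamma> e 0 = \<phi> v then {1/3..1} else {0..1}) \<inter>
    (if \<gamma> e 1 = \<phi> v then {0..2/3} else {0..1::real})" for e
  define Z where "Z = \<phi> ` (V - {v}) \<union> (\<Union>e\<in>E. \<gamma> e ` I e)"
  have I: "I e \<subseteq> {0..1}" "compact (I e)" for e by (auto simp: I_def)
  have "compact (\<gamma> e ` I e)" if "e \<in> E" for e
    using arc_\<gamma>[OF that] I continuous_on_subset[of "{0..1}" "\<gamma> e" "I e"]
    by (intro compact_continuous_image) (auto simp: arc_def path_def)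
  then have "closed Z"
    unfolding Z_def using finite_V finite_E
    by (intro compact_imp_closed compact_Un compact_UN finite_imp_compact[of "\<phi> ` (V - {v})"]) auto
  moreover have "\<phi> v \<notin> Z"
  proof
    assume "\<phi> v \<in> Z"
    moreover have "\<phi> v \<notin> \<phi> ` (V - {v})" using inj_on_image_mem_iff[OF inj_\<phi> assms, of "V - {v}"] by simp
    ultimately obtain e t where e: "e \<in> E" "t \<in> I e" "\<phi> v = \<gamma> e t" by (auto simp: Z_def)
    then have "\<not> (0 < t \<and> t < 1)" using \<gamma>_interior_neq[of e t v] assms by auto
    then have "t = 0 \<or> t = 1" using e I(1)[of e] by force
    then show False using e by (auto simp: I_def split: if_splits)
  qed
  ultimately obtain d where d: "d > 0" "ball (\<phi> v) d \<subseteq> - Z"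
    using open_contains_ball[of "- Z"] by auto
  have "drawing V E \<phi> \<gamma> \<subseteq> star v \<union> Z"
  proof
    fix x assume "x \<in> drawing V E \<phi> \<gamma>"
    then show "x \<in> star v \<union> Z"
    proof (cases rule: drawing_cases)
      case (1 u)
      then show ?thesis by (auto simp: Z_def star_def)
    next
      case (2 e t)
      then show ?thesis
      proof (cases "t \<in> I e")
        case True
        then show ?thesis using 2 by (auto simp: Z_def)
      next
        case False
        then have "\<gamma> e 0 = \<phi> v \<and> t \<le> 1 / 3 \<or> \<gamma> e 1 = \<phi> v \<and> 2 / 3 \<le> t"
          using 2 by (auto simp: I_def split: if_splits)
        then show ?thesis using 2 by (simp add: star_edgeI)
      qed
    qed
  qed
  then show ?thesis using d by blast
qed

lemma path_component_image:
  assumes "e \<in> E" "0 \<le> a" "a \<le> b" "b \<le> 1" "\<gamma> e ` {a..b} \<subseteq> X" "s \<in> {a..b}" "t \<in> {a..b}"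
  shows "path_component X (\<gamma> e s) (\<gamma> e t)"
proof -
  have "continuous_on {a..b} (\<gamma> e)"
    using arc_\<gamma>[OF assms(1)] assms by (auto simp: arc_def path_def intro: continuous_on_subset)
  then have "path_connected (\<gamma> e ` {a..b})"
    by (intro path_connected_continuous_image) (auto intro: convex_imp_path_connected)
  then have "path_component (\<gamma> e ` {a..b}) (\<gamma> e s) (\<gamma> e t)"
    using assms by (auto simp: path_connected_component)
  then show ?thesis using assms(5) path_component_of_subset by blast
qed

lemma star_path_component:
  assumes "x \<in> star v"
  shows "path_component (star v) (\<phi> v) x"
  using assms
proof (cases rule: star_cases)
  case 1
  then show ?thesis using assms by (simp add: path_component_refl)
next
  case (2 e t)
  have "\<gamma> e ` {0..t} \<subseteq> star v"
  proof clarify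
    fix s assume "s \<in> {0..t}"
    then consider "s = 0" | "0 < s" "s < 1" "s \<le> 1 / 3" using 2 by force
    then show "\<gamma> e s \<in> star v" using 2 star_center[of v] by cases (auto intro: star_edgeI)
  qed
  then have "path_component (star v) (\<gamma> e 0) (\<gamma> e t)"
    using 2 by (intro path_component_image[where a=0 and b=t]) auto
  then show ?thesis using 2 by simp
next
  case (3 e t)
  have "\<gamma> e ` {t..1} \<subseteq> star v"
  proof clarify
    fix s assume "s \<in> {t..1}"
    then consider "s = 1" | "0 < s" "s < 1" "2 / 3 \<le> s" using 3 by force
    then show "\<gamma> e s \<in> star v" using 3 star_center[of v] by cases (auto intro: star_edgeI)
  qed
  then have "path_component (star v) (\<gamma> e 1) (\<gamma> e t)"
    using 3 by (intro path_component_image[where a=t and b=1]) auto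
  then show ?thesis using 3 by simp
qed

lemma linked_path_component:
  assumes "linked_within ends E S u v" "x \<in> star u" "y \<in> star v"
  shows "path_component (region S) x y"
proof -
  let ?R = "\<lambda>x y. x \<in> S \<and> y \<in> S \<and> (\<exists>e\<in>E. ends e = {x, y})"
  have "?R\<^sup>*\<^sup>* u v" "u \<in> S" using assms by (auto simp: linked_within_def)
  then have "v \<in> S \<and> path_component (region S) (\<phi> u) (\<phi> v)"
  proof induction
    case base
    then have "\<phi> u \<in> region S" using star_subset_region by (auto simp: star_def)
    then show ?case using base by (simp add: path_component_refl)
  next
    case (step v w)
    then obtain e where e: "e \<in> E" "ends e = {v, w}" "v \<in> S" "w \<in> S" by blast
    then have sub: "path_image (\<gamma> e) \<subseteq> region S" by (auto simp: region_def)
    have vw: "{\<gamma> e 0, \<gamma> e 1} = {\<phi> v, \<phi> w}" using \<gamma>_ends[OF e(1)] e by simp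
    have *: "path_component (region S) (\<gamma> e s) (\<gamma> e t)" if "s \<in> {0..1}" "t \<in> {0..1}" for s t
      using that sub e(1) unfolding path_image_def
      by (intro path_component_image[where a=0 and b=1]) auto
    have "path_component (region S) (\<phi> v) (\<phi> w)"
      using vw *[of 0 1] *[of 1 0] unfolding doubleton_eq_iff by auto
    then show ?case using step e path_component_trans by metis
  qed
  moreover from this have "path_component (region S) (\<phi> v) y"
    using star_path_component[OF assms(3)] star_subset_region path_component_of_subset by metis
  moreover have "path_component (region S) (\<phi> u) x"
    using star_path_component[OF assms(2)] \<open>u \<in> S\<close> star_subset_region path_component_of_subset by metis
  ultimately show ?thesis using path_component_trans path_component_sym by metis
qed

lemma path_through_fan:
  assumes fan: "fan (drawing V E \<phi> \<gamma>) c star T \<alpha>" and "u \<in> T" "v \<in> T" "linked_within ends E S u v"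
  obtains f where "path f" "pathstart f = pathfinish (\<alpha> u)" "pathfinish f = pathfinish (\<alpha> v)"
    "path_image f \<subseteq> path_image (\<alpha> u) \<union> region S \<union> path_image (\<alpha> v)"
proof -
  have "pathstart (\<alpha> u) \<in> star u" "pathstart (\<alpha> v) \<in> star v" "arc (\<alpha> u)" "arc (\<alpha> v)"
    using fanD[OF fan] assms(2,3) by simp_all
  moreover from this obtain h where h: "path h" "path_image h \<subseteq> region S"
    "pathstart h = pathstart (\<alpha> u)" "pathfinish h = pathstart (\<alpha> v)"
    using linked_path_component[OF assms(4)] unfolding path_component_def by metis
  ultimately show ?thesis
    by (intro that[of "reversepath (\<alpha> u) +++ h +++ \<alpha> v"])
      (auto simp: arc_imp_path path_image_join)
qed

text \<open>If \<open>S\<close> and \<open>S'\<close> were disjoint, then so would be their regions and the legs at their vertices. A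
  path down each leg and through the region would give two disjoint paths above the
  line whose ends interlace.\<close>

lemma feet_do_not_interlace:
  assumes fan: "fan (drawing V E \<phi> \<gamma>) c star T \<alpha>" and "T \<subseteq> V"
    and "drawing V E \<phi> \<gamma> \<subseteq> {z. c < Im z}"
    and T: "u \<in> T" "v \<in> T" "u' \<in> T" "v' \<in> T"
    and link: "linked_within ends E S u v" "linked_within ends E S' u' v'"
    and less: "Re (pathfinish (\<alpha> u)) < Re (pathfinish (\<alpha> u'))"
      "Re (pathfinish (\<alpha> u')) < Re (pathfinish (\<alpha> v))"
      "Re (pathfinish (\<alpha> v)) < Re (pathfinish (\<alpha> v'))"
  shows "S \<inter> S' \<noteq> {}"
proof
  assume disj: "S \<inter> S' = {}"
  define R R' where "R = S \<inter> V" and "R' = S' \<inter> V"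
  have R: "linked_within ends E R u v" "linked_within ends E R' u' v'"
    unfolding R_def R'_def using T \<open>T \<subseteq> V\<close> ends_subset
    by (auto intro!: linked_within_restrict link)
  have sub: "R \<subseteq> V" "R' \<subseteq> V" "R \<inter> R' = {}" using disj by (auto simp: R_def R'_def)
  have mem: "u \<in> R" "v \<in> R" "u' \<in> R'" "v' \<in> R'" using linked_within_mem R by metis+
  obtain f where f: "path f" "pathstart f = pathfinish (\<alpha> u)" "pathfinish f = pathfinish (\<alpha> v)"
    "path_image f \<subseteq> path_image (\<alpha> u) \<union> region R \<union> path_image (\<alpha> v)"
    using path_through_fan[OF fan T(1,2) R(1)] .
  obtain g where g: "path g" "pathstart g = pathfinish (\<alpha> u')" "pathfinish g = pathfinish (\<alpha> v')"
    "path_image g \<subseteq> path_image (\<alpha> u') \<union> region R' \<union> path_image (\<alpha> v')"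
    using path_through_fan[OF fan T(3,4) R(2)] .
  have leg: "path_image (\<alpha> s) \<inter> region Q = {}" if "s \<in> T" "s \<notin> Q" "Q \<subseteq> V" for s Q
  proof -
    have "region Q \<subseteq> drawing V E \<phi> \<gamma>" using that by (intro region_subset_drawing)
    then have "path_image (\<alpha> s) \<inter> region Q \<subseteq> {pathstart (\<alpha> s)}" using fanD(3)[OF fan that(1)] by blast
    then have "path_image (\<alpha> s) \<inter> region Q \<subseteq> star s" using fanD(2)[OF fan that(1)] by auto
    moreover have "star s \<inter> region Q = {}"
      using region_disjoint[of "{s}" Q] star_subset_region[of s "{s}"] that \<open>T \<subseteq> V\<close> by blast
    ultimately show ?thesis by blast
  qed
  have legs: "path_image (\<alpha> s) \<inter> path_image (\<alpha> t) = {}" if "s \<in> R" "t \<in> R'" "s \<in> T" "t \<in> T" for s t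
  proof -
    have "s \<noteq> t" using sub that by blast
    then show ?thesis using fan_disjoint[OF fan] that by simp
  qed
  have "u \<notin> R'" "v \<notin> R'" "u' \<notin> R" "v' \<notin> R" using mem sub by auto
  then have "(path_image (\<alpha> u) \<union> region R \<union> path_image (\<alpha> v)) \<inter>
      (path_image (\<alpha> u') \<union> region R' \<union> path_image (\<alpha> v')) = {}"
    using leg[of u R'] leg[of v R'] leg[of u' R] leg[of v' R] T mem sub
      legs[of u u'] legs[of u v'] legs[of v u'] legs[of v v'] region_disjoint[of R R']
    by (simp add: Int_Un_distrib Int_Un_distrib2 Int_commute)
  then have "path_image f \<inter> path_image g = {}"
    using Int_mono[OF f(4) g(4)] by simp
  moreover have "path_image f \<inter> path_image g \<noteq> {}"
  proof (rule complex_paths_interlace[where c=c])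
    have "drawing V E \<phi> \<gamma> \<subseteq> {z. c \<le> Im z}" using assms(3) by auto
    then have "region R \<subseteq> {z. c \<le> Im z}" "region R' \<subseteq> {z. c \<le> Im z}"
      using region_subset_drawing[OF sub(1)] region_subset_drawing[OF sub(2)] by (meson order_trans)+
    then show "path_image f \<union> path_image g \<subseteq> {z. c \<le> Im z}"
      by (intro Un_least order_trans[OF f(4)] order_trans[OF g(4)] fanD(5)[OF fan] T)
  qed (use f g fanD(4)[OF fan] T less in auto)
  ultimately show False by blast
qed

text \<open>The feet of a fan are read from left to right, starting just after the foot of \<open>r\<close> and wrapping around.
  Then \<open>r, i, b, k\<close> are in cyclic order whenever \<open>i\<close> precedes \<open>b\<close> and \<open>b\<close> precedes \<open>k\<close>, so the pairs
  \<open>r, b\<close> and \<open>i, k\<close> interlace.\<close>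

theorem exists_noncrossing_order:
  assumes "r \<in> V" "B \<subseteq> V" "r \<notin> B"
    and outer: "\<And>v. v \<in> insert r B \<Longrightarrow> \<phi> v \<in> frontier (outer_face V E \<phi> \<gamma>)"
  obtains bs where "set bs = B" "noncrossing_order ends E r bs"
proof -
  let ?K = "drawing V E \<phi> \<gamma>" and ?T = "insert r B"
  have "finite B" using assms finite_V finite_subset by blast
  obtain M where M: "\<And>z. z \<in> ?K \<Longrightarrow> norm z \<le> M"
    using compact_imp_bounded[OF compact_drawing] by (auto simp: bounded_iff)
  define c where "c = - M - 1"
  have above: "?K \<subseteq> {z. c < Im z}"
  proof
    fix z assume "z \<in> ?K"
    then show "z \<in> {z. c < Im z}" using M[of z] abs_Im_le_cmod[of z] by (simp add: c_def)
  qed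
  have T_V: "?T \<subseteq> V" using assms by simp
  have "\<exists>\<alpha>. fan ?K c star ?T \<alpha>"
  proof (rule exists_fan[OF compact_drawing above, where z = \<phi>])
    show "\<exists>d>0. ball (\<phi> t) d \<inter> ?K \<subseteq> star t" if "t \<in> ?T" for t
      using drawing_near_vertex that T_V by (meson subsetD)
    show "star s \<inter> star t = {}" if "s \<in> ?T" "t \<in> ?T" "s \<noteq> t" for s t
      using star_disjoint that T_V by (meson subsetD)
  qed (use outer \<open>finite B\<close> in \<open>auto simp: outer_face_def\<close>)
  then obtain \<alpha> where fan: "fan ?K c star ?T \<alpha>" by blast
  define F where "F t = Re (pathfinish (\<alpha> t))" for t
  have F_inj: "F s \<noteq> F t" if "s \<in> ?T" "t \<in> ?T" "s \<noteq> t" for s t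
  proof
    assume "F s = F t"
    then have "pathfinish (\<alpha> s) = pathfinish (\<alpha> t)"
      using fanD(4)[OF fan that(1)] fanD(4)[OF fan that(2)] by (simp add: F_def complex_eq_iff)
    then have "path_image (\<alpha> s) \<inter> path_image (\<alpha> t) \<noteq> {}"
      using pathfinish_in_path_image[of "\<alpha> s"] pathfinish_in_path_image[of "\<alpha> t"] by auto
    then show False using fan_disjoint[OF fan that] by simp
  qed
  \<comment> \<open>The map \<open>x \<mapsto> - 1 / x\<close> is increasing on each half-line and puts the positive numbers before the negative ones.\<close>
  define \<kappa> where "\<kappa> b = - 1 / (F b - F r)" for b
  have Fr: "F b \<noteq> F r" if "b \<in> B" for b using F_inj[of b r] that assms by auto
  have \<kappa>_inj: "\<kappa> s \<noteq> \<kappa> t" if "s \<in> B" "t \<in> B" "s \<noteq> t" for s t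
    using F_inj[of s t] Fr that by (auto simp: \<kappa>_def field_simps)
  obtain xs where xs: "set xs = B" "distinct xs" using finite_distinct_list[OF \<open>finite B\<close>] by blast
  define bs where "bs = sort_key \<kappa> xs"
  have bs: "set bs = B" "distinct bs" "sorted (map \<kappa> bs)" using xs by (auto simp: bs_def)
  have "noncrossing_order ends E r bs"
    unfolding noncrossing_order_def
  proof (intro allI impI)
    fix pre b post i k S S'
    assume split: "bs = pre @ b # post" and i: "i \<in> set pre" and k: "k \<in> set post"
      and link: "linked_within ends E S r b" "linked_within ends E S' i k"
    have B: "i \<in> B" "b \<in> B" "k \<in> B" using split i k bs by auto
    have "\<kappa> i \<le> \<kappa> b" "\<kappa> b \<le> \<kappa> k" "i \<noteq> b" "b \<noteq> k"
      using bs split i k by (auto simp: sorted_append)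
    then have less: "\<kappa> i < \<kappa> b" "\<kappa> b < \<kappa> k" using \<kappa>_inj B by (auto simp: order_less_le)
    have cross: "S \<inter> S' \<noteq> {}" if "F u < F u'" "F u' < F v" "F v < F v'"
      "u \<in> ?T" "v \<in> ?T" "u' \<in> ?T" "v' \<in> ?T"
      "linked_within ends E S u v \<and> linked_within ends E S' u' v' \<or>
       linked_within ends E S' u v \<and> linked_within ends E S u' v'" for u v u' v'
      using feet_do_not_interlace[OF fan T_V above that(4,5,6,7), of S S']
        feet_do_not_interlace[OF fan T_V above that(4,5,6,7), of S' S] that(1,2,3,8)
      unfolding F_def by (simp add: Int_commute) blast
    note link' = link[THEN linked_within_sym]
    have inverse_mono: "x < y" if "- 1 / x < - 1 / y" "0 < x \<and> 0 < y \<or> x < 0 \<and> y < 0" for x y :: real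
      using that by (auto simp: divide_simps split: if_splits)
    have sgn: "F s < F t" if "\<kappa> s < \<kappa> t" "F s < F r \<and> F t < F r \<or> F r < F s \<and> F r < F t" for s t
      using inverse_mono[of "F s - F r" "F t - F r"] that by (auto simp: \<kappa>_def)
    have \<kappa>_pos: "0 < \<kappa> t \<longleftrightarrow> F t < F r" for t
      by (auto simp: \<kappa>_def zero_less_divide_iff)
    have neg: "F b < F r" if "F i < F r"
      using that less(1) unfolding \<kappa>_pos[symmetric] by linarith
    have neg': "F k < F r" if "F b < F r"
      using that less(2) unfolding \<kappa>_pos[symmetric] by linarith
    \<comment> \<open>The four ways in which the linear order of the feet can cut the cyclic order.\<close>
    consider "F r < F i" "F r < F b" "F r < F k" | "F r < F i" "F r < F b" "F k < F r"
      | "F r < F i" "F b < F r" "F k < F r" | "F i < F r" "F b < F r" "F k < F r"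
      using neg neg' Fr[OF B(1)] Fr[OF B(2)] Fr[OF B(3)] by linarith
    then show "S \<inter> S' \<noteq> {}"
    proof cases
      case 1
      then show ?thesis using cross[of r i b k] sgn less B link by blast
    next
      case 2
      then show ?thesis using cross[of k r i b] sgn less B link link' by blast
    next
      case 3
      then show ?thesis using cross[of b k r i] sgn less B link link' by blast
    next
      case 4
      then show ?thesis using cross[of i b k r] sgn less B link link' by blast
    qed
  qed
  then show ?thesis using that bs by blast
qed

end

section \<open>Bernoulli percolation and the inequality\<close>

text \<open>A walk extended by one edge either stays a path or is cut back to the earlier visit of its new end.\<close>

lemma joined_by_path_iff:
  assumes "\<And>e. e \<in> F \<Longrightarrow> ends e \<subseteq> V"
  shows "joined_by_path V ends F u v \<longleftrightarrow> u \<in> V \<and> v \<in> cluster ends F u"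
proof
  assume "joined_by_path V ends F u v"
  then obtain vs es where path: "length vs = Suc (length es)" "set vs \<subseteq> V" "set es \<subseteq> F"
    "hd vs = u" "last vs = v" "\<And>i. i < length es \<Longrightarrow> ends (es ! i) = {vs ! i, vs ! Suc i}"
    unfolding joined_by_path_def by blast
  have "vs \<noteq> []" using path(1) by auto
  have "vs ! i \<in> cluster ends F u" if "i \<le> length es" for i
    using that
  proof (induction i)
    case 0
    then show ?case using path(4) \<open>vs \<noteq> []\<close> by (simp add: hd_conv_nth)
  next
    case (Suc i)
    then have "es ! i \<in> F" using path(3) by auto
    then show ?case using Suc path(6)[of i] cluster_step[of "vs ! i" ends F u "es ! i"] by simp
  qed
  from this[of "length es"] have "v \<in> cluster ends F u"
    using path(1,5) \<open>vs \<noteq> []\<close> by (simp add: last_conv_nth)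
  moreover have "u \<in> V" using path(2,4) \<open>vs \<noteq> []\<close> by auto
  ultimately show "u \<in> V \<and> v \<in> cluster ends F u" by simp
next
  assume "u \<in> V \<and> v \<in> cluster ends F u"
  then have "u \<in> V" "(\<lambda>x y. \<exists>e\<in>F. ends e = {x, y})\<^sup>*\<^sup>* u v" by (auto simp: cluster_def)
  from this(2) show "joined_by_path V ends F u v"
  proof induction
    case base
    show ?case unfolding joined_by_path_def
      using \<open>u \<in> V\<close> by (intro exI[of _ "[u]"] exI[of _ "[]"]) simp
  next
    case (step y z)
    obtain e where e: "e \<in> F" "ends e = {y, z}" using step.hyps(2) by blast
    obtain vs es where path: "length vs = Suc (length es)" "distinct vs" "set vs \<subseteq> V" "set es \<subseteq> F"
      "hd vs = u" "last vs = y" "\<And>i. i < length es \<Longrightarrow> ends (es ! i) = {vs ! i, vs ! Suc i}"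
      using step.IH unfolding joined_by_path_def by blast
    have "vs \<noteq> []" using path(1) by auto
    show ?case
    proof (cases "z \<in> set vs")
      case True
      then obtain i where i: "i < length vs" "vs ! i = z" by (auto simp: in_set_conv_nth)
      show ?thesis
        unfolding joined_by_path_def
      proof (intro exI conjI allI impI)
        show "length (take (Suc i) vs) = Suc (length (take i es))" using i path(1) by simp
        show "distinct (take (Suc i) vs)" using path(2) by simp
        show "set (take (Suc i) vs) \<subseteq> V" "set (take i es) \<subseteq> F"
          using path(3,4) set_take_subset by (metis order_trans)+
        show "hd (take (Suc i) vs) = u" using path(5) by simp
        show "last (take (Suc i) vs) = z" using i by (simp add: take_Suc_conv_app_nth)
        show "ends (take i es ! j) = {take (Suc i) vs ! j, take (Suc i) vs ! Suc j}"
          if "j < length (take i es)" for j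
          using path(7)[of j] that by simp
      qed
    next
      case False
      show ?thesis
        unfolding joined_by_path_def
      proof (intro exI conjI allI impI)
        show "length (vs @ [z]) = Suc (length (es @ [e]))" using path(1) by simp
        show "distinct (vs @ [z])" using path(2) False by simp
        show "set (vs @ [z]) \<subseteq> V" "set (es @ [e]) \<subseteq> F" using path(3,4) e assms[OF e(1)] by auto
        show "hd (vs @ [z]) = u" using path(5) \<open>vs \<noteq> []\<close> by simp
        show "last (vs @ [z]) = z" by simp
        show "ends ((es @ [e]) ! j) = {(vs @ [z]) ! j, (vs @ [z]) ! Suc j}"
          if "j < length (es @ [e])" for j
        proof (cases "j < length es")
          case True
          then show ?thesis using path(1) path(7)[of j] by (simp add: nth_append)
        next
          case False
          then have "j = length es" using that by simp
          moreover have "vs ! length es = y" using path(1,6) \<open>vs \<noteq> []\<close> by (simp add: last_conv_nth)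
          ultimately show ?thesis using e path(1) by (simp add: nth_append)
        qed
      qed
    qed
  qed
qed

locale percolation = prob_space M
  for M :: "'w measure" and E :: "'e set" and p :: real and \<pi> :: "'e \<Rightarrow> 'w \<Rightarrow> bool" +
  assumes finite_E: "finite E" and p: "0 < p" "p < 1"
    and bernoulli: "bernoulli_percolation M E p \<pi>"
begin

definition config_event :: "'e set \<Rightarrow> 'w set" where
  "config_event \<omega> = {x \<in> space M. {e \<in> E. \<pi> e x} = \<omega>}"

lemma config_event_alt:
  "\<omega> \<subseteq> E \<Longrightarrow> config_event \<omega> = {x \<in> space M. \<forall>e\<in>E. \<pi> e x = (e \<in> \<omega>)}"
  by (auto simp: config_event_def)

lemma measurable_\<pi>: "e \<in> E \<Longrightarrow> \<pi> e \<in> measurable M (count_space UNIV)"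
  using bernoulli by (simp add: bernoulli_percolation_def indep_vars_def2)

lemma sets_config_event [measurable]: "\<omega> \<subseteq> E \<Longrightarrow> config_event \<omega> \<in> sets M"
  unfolding config_event_alt using finite_E measurable_\<pi> by measurable

lemma prob_config_event:
  assumes "\<omega> \<subseteq> E"
  shows "prob (config_event \<omega>) = bernoulli_weight p E \<omega>"
proof (cases "E = {}")
  case True
  then have "config_event \<omega> = space M" using assms unfolding config_event_def by auto
  then show ?thesis using True by (simp add: bernoulli_weight_def prob_space)
next
  case False
  have marginal: "prob (\<pi> e -` {b} \<inter> space M) = (if b then p else 1 - p)" if "e \<in> E" for e b
  proof -
    have "prob (\<pi> e -` {b} \<inter> space M) = measure (distr M (count_space UNIV) (\<pi> e)) {b}"
      using measurable_\<pi>[OF that] by (simp add: measure_distr)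
    also have "\<dots> = pmf (bernoulli_pmf p) b"
      using bernoulli that by (simp add: bernoulli_percolation_def measure_pmf_single)
    finally show ?thesis using p by (cases b) simp_all
  qed
  have "config_event \<omega> = (\<Inter>e\<in>E. \<pi> e -` {e \<in> \<omega>} \<inter> space M)"
    unfolding config_event_alt[OF assms] using False by auto
  also have "prob \<dots> = (\<Prod>e\<in>E. prob (\<pi> e -` {e \<in> \<omega>} \<inter> space M))"
    using bernoulli finite_E False
    by (intro indep_varsD_finite) (auto simp: bernoulli_percolation_def)
  finally show ?thesis by (simp add: marginal bernoulli_weight_def)
qed

lemma config_event_partition:
  assumes "S \<subseteq> space M"
  shows "S = (\<Union>\<omega>\<in>Pow E. S \<inter> config_event \<omega>)"
proof (intro equalityI subsetI)
  fix x assume "x \<in> S"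
  then have "x \<in> S \<inter> config_event {e \<in> E. \<pi> e x}" using assms by (auto simp: config_event_def)
  then show "x \<in> (\<Union>\<omega>\<in>Pow E. S \<inter> config_event \<omega>)" by (intro UN_I[of "{e \<in> E. \<pi> e x}"]) auto
qed blast

lemma prob_config_sum:
  assumes "S \<in> sets M"
  shows "prob S = (\<Sum>\<omega>\<in>Pow E. prob (S \<inter> config_event \<omega>))"
proof -
  note config_event_partition[OF sets.sets_into_space[OF assms]]
  also have "prob (\<Union>\<omega>\<in>Pow E. S \<inter> config_event \<omega>) = (\<Sum>\<omega>\<in>Pow E. prob (S \<inter> config_event \<omega>))"
    using finite_E assms sets_config_event
    by (intro finite_measure_finite_Union) (auto simp: disjoint_family_on_def config_event_def)
  finally show ?thesis .
qed

definition prob_given_config :: "'w set \<Rightarrow> 'e set \<Rightarrow> real" where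
  "prob_given_config A \<omega> = prob (A \<inter> config_event \<omega>) / bernoulli_weight p E \<omega>"

lemma weight_pos: "0 < bernoulli_weight p E \<omega>"
  using bernoulli_weight_pos p by blast

lemma prob_given_config_bounds:
  assumes "\<omega> \<subseteq> E"
  shows "0 \<le> prob_given_config A \<omega>" "prob_given_config A \<omega> \<le> 1"
proof -
  have "prob (A \<inter> config_event \<omega>) \<le> bernoulli_weight p E \<omega>"
    using finite_measure_mono[of "A \<inter> config_event \<omega>" "config_event \<omega>"] assms
    by (simp add: sets_config_event prob_config_event)
  then show "0 \<le> prob_given_config A \<omega>" "prob_given_config A \<omega> \<le> 1"
    using weight_pos[of \<omega>] by (simp_all add: prob_given_config_def)
qed

lemma weight_prob_given_config: "bernoulli_weight p E \<omega> * prob_given_config A \<omega> = prob (A \<inter> config_event \<omega>)"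
  using weight_pos[of \<omega>] by (simp add: prob_given_config_def)

lemma prob_given_config_mono:
  assumes "A \<in> sets M" "increasing_event M E \<pi> A"
  shows "mono_on (Pow E) (prob_given_config A)"
proof (rule monotone_onI)
  fix \<omega> \<omega>' assume \<omega>: "\<omega> \<in> Pow E" "\<omega>' \<in> Pow E" "\<omega> \<subseteq> \<omega>'"
  let ?c = "\<lambda>\<omega>. cond_prob M (\<lambda>x. x \<in> A) (\<lambda>x. \<forall>e\<in>E. \<pi> e x = restrict (\<lambda>e. e \<in> \<omega>) E e)"
  have eq: "?c \<omega> = prob_given_config A \<omega>" if "\<omega> \<subseteq> E" for \<omega>
  proof -
    have "{x \<in> space M. \<forall>e\<in>E. \<pi> e x = restrict (\<lambda>e. e \<in> \<omega>) E e} = config_event \<omega>"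
      unfolding config_event_alt[OF that] by auto
    moreover have "{x \<in> space M. x \<in> A \<and> (\<forall>e\<in>E. \<pi> e x = restrict (\<lambda>e. e \<in> \<omega>) E e)} = A \<inter> config_event \<omega>"
      unfolding config_event_alt[OF that] using sets.sets_into_space[OF assms(1)] by auto
    ultimately show ?thesis by (simp add: cond_prob_def prob_given_config_def prob_config_event[OF that])
  qed
  have le: "restrict (\<lambda>e. e \<in> \<omega>) E \<le> restrict (\<lambda>e. e \<in> \<omega>') E"
    using \<omega>(3) by (intro le_funI) (simp add: restrict_def subset_iff)
  have "restrict (\<lambda>e. e \<in> \<omega>) E \<in> E \<rightarrow>\<^sub>E UNIV" for \<omega> by simp
  then have "?c \<omega> \<le> ?c \<omega>'"
    using monotone_onD[OF assms(2)[unfolded increasing_event_def], OF _ _ le] by blast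
  then show "prob_given_config A \<omega> \<le> prob_given_config A \<omega>'" using eq \<omega> by simp
qed

lemma connection_event_Int_config:
  assumes "\<And>e. e \<in> E \<Longrightarrow> ends e \<subseteq> V" "r \<in> V"
  shows "connection_event M V E ends \<pi> r b \<inter> config_event \<omega> =
    (if b \<in> cluster ends \<omega> r then config_event \<omega> else {})"
proof -
  have "joined_by_path V ends {e \<in> E. \<pi> e x} r b \<longleftrightarrow> b \<in> cluster ends {e \<in> E. \<pi> e x} r" for x
    using assms by (subst joined_by_path_iff) auto
  then show ?thesis by (auto simp: connection_event_def config_event_def)
qed

lemma sets_connection_event:
  assumes "\<And>e. e \<in> E \<Longrightarrow> ends e \<subseteq> V" "r \<in> V"
  shows "connection_event M V E ends \<pi> r b \<in> sets M"
proof -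
  let ?C = "connection_event M V E ends \<pi> r b"
  have "?C \<inter> config_event \<omega> \<in> sets M" if "\<omega> \<in> Pow E" for \<omega>
    using sets_config_event[of \<omega>] that by (simp add: connection_event_Int_config[OF assms])
  then have "(\<Union>\<omega>\<in>Pow E. ?C \<inter> config_event \<omega>) \<in> sets M"
    using finite_E by (intro sets.finite_UN) simp_all
  moreover have "?C \<subseteq> space M" by (simp add: connection_event_def)
  ultimately show ?thesis using config_event_partition[of ?C] by metis
qed

text \<open>The transfer from the probability space to the cube: summing over the configurations turns both
  probabilities into weighted sums, to which \<open>exploration_bound\<close> applies with \<open>h\<close> the conditional
  probability of the union. Planarity enters only through the order of the targets.\<close>

theorem connection_to_noncrossing_targets:
  assumes ends: "\<And>e. e \<in> E \<Longrightarrow> ends e \<subseteq> V" "\<And>e. e \<in> E \<Longrightarrow> card (ends e) = 2" "r \<in> V"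
    and order: "noncrossing_order ends E r bs"
    and \<epsilon>: "0 < \<epsilon>" "\<epsilon> \<le> 1"
    and Ev: "\<And>b. b \<in> set bs \<Longrightarrow> Ev b \<in> sets M" "\<And>b. b \<in> set bs \<Longrightarrow> increasing_event M E \<pi> (Ev b)"
      "\<And>b. b \<in> set bs \<Longrightarrow> prob (Ev b) \<ge> 1 - \<epsilon>"
  shows "(1 - 2 * sqrt \<epsilon>) * prob (\<Union>b\<in>set bs. connection_event M V E ends \<pi> r b)
    \<le> prob (\<Union>b\<in>set bs. connection_event M V E ends \<pi> r b \<inter> Ev b)"
proof -
  let ?W = "bernoulli_weight p E"
  let ?C = "connection_event M V E ends \<pi> r"
  define U where "U = (\<Union>b\<in>set bs. ?C b \<inter> Ev b)"
  define g where "g b \<omega> = 1 - prob_given_config (Ev b) \<omega>" for b \<omega>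
  let ?conn = "{\<omega>. \<omega> \<subseteq> E \<and> (\<exists>b\<in>set bs. r \<in> cluster ends \<omega> b)}"
  have C: "?C b \<inter> config_event \<omega> = (if r \<in> cluster ends \<omega> b then config_event \<omega> else {})" for b \<omega>
    using connection_event_Int_config[where ends=ends and V=V, OF ends(1,3), of b \<omega>] unfolding cluster_commute[where u=r and v=b] .
  have C_Union: "(\<Union>b\<in>set bs. ?C b) \<inter> config_event \<omega> =
      (if \<exists>b\<in>set bs. r \<in> cluster ends \<omega> b then config_event \<omega> else {})" for \<omega>
  proof -
    have "(\<Union>b\<in>set bs. ?C b) \<inter> config_event \<omega> = (\<Union>b\<in>set bs. ?C b \<inter> config_event \<omega>)" by simp
    then show ?thesis unfolding C by auto
  qed
  have sets_C: "?C b \<in> sets M" for b using sets_connection_event[where ends=ends and V=V, OF ends(1,3)] .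
  have sets_U: "U \<in> sets M" unfolding U_def using sets_C Ev(1) by (intro sets.finite_UN sets.Int) auto
  interpret exploration E ends p "sqrt \<epsilon>" r g bs
  proof
    fix b assume b: "b \<in> set bs"
    show "antimono_on (Pow E) (g b)"
      using prob_given_config_mono[OF Ev(1)[OF b] Ev(2)[OF b]] by (auto simp: monotone_on_def g_def)
    show "0 \<le> g b \<omega>" if "\<omega> \<subseteq> E" for \<omega>
      using prob_given_config_bounds(2)[OF that] by (simp add: g_def)
    have "(\<Sum>\<omega>\<in>Pow E. ?W \<omega> * g b \<omega>) = 1 - prob (Ev b)"
      using sum_bernoulli_weight[OF finite_E, of p]
      by (simp add: g_def right_diff_distrib sum_subtractf weight_prob_given_config prob_config_sum[OF Ev(1)[OF b]])
    then show "(\<Sum>\<omega>\<in>Pow E. ?W \<omega> * g b \<omega>) \<le> (sqrt \<epsilon>)\<^sup>2"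
      using Ev(3)[OF b] \<epsilon> by simp
  qed (use finite_E p ends order \<epsilon> in auto)
  have "prob (\<Union>b\<in>set bs. ?C b) = (\<Sum>\<omega>\<in>Pow E. prob ((\<Union>b\<in>set bs. ?C b) \<inter> config_event \<omega>))"
    using sets_C by (intro prob_config_sum) auto
  also have "\<dots> = (\<Sum>\<omega>\<in>?conn. ?W \<omega>)"
  proof (rule sum.mono_neutral_cong_right)
    show "\<forall>\<omega>\<in>Pow E - ?conn. prob ((\<Union>b\<in>set bs. ?C b) \<inter> config_event \<omega>) = 0"
      unfolding C_Union by simp
    fix \<omega> assume "\<omega> \<in> ?conn"
    then show "prob ((\<Union>b\<in>set bs. ?C b) \<inter> config_event \<omega>) = ?W \<omega>"
      unfolding C_Union using prob_config_event[of \<omega>] by simp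
  qed (use finite_E in auto)
  finally have "(1 - 2 * sqrt \<epsilon>) * prob (\<Union>b\<in>set bs. ?C b) = (1 - 2 * sqrt \<epsilon>) * (\<Sum>\<omega>\<in>?conn. ?W \<omega>)"
    by simp
  also have "\<dots> \<le> (\<Sum>\<omega>\<in>?conn. ?W \<omega> * prob_given_config U \<omega>)"
  proof (rule exploration_bound)
    fix \<omega> b assume \<omega>: "\<omega> \<subseteq> E" and b: "b \<in> set bs" "r \<in> cluster ends \<omega> b"
    have "config_event \<omega> \<subseteq> ?C b" using C[of b \<omega>] b(2) by auto
    then have "Ev b \<inter> config_event \<omega> \<subseteq> U \<inter> config_event \<omega>" using b(1) unfolding U_def by blast
    then have "prob (Ev b \<inter> config_event \<omega>) \<le> prob (U \<inter> config_event \<omega>)"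
      using sets_U sets_config_event[OF \<omega>] by (intro finite_measure_mono) auto
    then show "1 - g b \<omega> \<le> prob_given_config U \<omega>"
      using weight_pos[of \<omega>] by (simp add: g_def prob_given_config_def divide_right_mono)
  qed (use prob_given_config_bounds \<epsilon> in auto)
  also have "\<dots> \<le> (\<Sum>\<omega>\<in>Pow E. ?W \<omega> * prob_given_config U \<omega>)"
    using finite_E weight_prob_given_config by (intro sum_mono2) auto
  also have "\<dots> = prob U"
    by (simp add: weight_prob_given_config prob_config_sum[OF sets_U])
  finally show ?thesis by (simp add: U_def)
qed

end

theorem theorem2p3:
  fixes V :: "'v set" and E :: "'e set" and ends :: "'e \<Rightarrow> 'v set"
    and \<phi> :: "'v \<Rightarrow> complex" and \<gamma> :: "'e \<Rightarrow> real \<Rightarrow> complex"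
    and r :: 'v and B :: "'v set" and p \<epsilon> :: real
    and M :: "'w measure" and \<pi> :: "'e \<Rightarrow> 'w \<Rightarrow> bool" and Ev :: "'v \<Rightarrow> 'w set"
  assumes "finite_loopless_multigraph V E ends"
    and "r \<in> V" and "B \<subseteq> V"
    and "0 < p" and "p < 1"
    and "planar_embedding V E ends \<phi> \<gamma>"
    and "\<And>v. v \<in> {r} \<union> B \<Longrightarrow> \<phi> v \<in> frontier (outer_face V E \<phi> \<gamma>)"
    and "prob_space M"
    and "bernoulli_percolation M E p \<pi>"
    and "0 < \<epsilon>"
    and "\<And>b. b \<in> B \<Longrightarrow> Ev b \<in> sets M"
    and "\<And>b. b \<in> B \<Longrightarrow> increasing_event M E \<pi> (Ev b)"
    and "\<And>b. b \<in> B \<Longrightarrow> measure M (Ev b) \<ge> 1 - \<epsilon>"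
  shows "measure M (\<Union>b\<in>B. connection_event M V E ends \<pi> r b \<inter> Ev b)
           \<ge> (1 - 2 * sqrt \<epsilon>) * measure M (\<Union>b\<in>B. connection_event M V E ends \<pi> r b)"
proof -
  interpret plane_graph V E ends \<phi> \<gamma>
    using assms(1,6) by unfold_locales
  interpret percolation M E p \<pi>
    using assms(4,5,8,9) finite_E by (intro percolation.intro percolation_axioms.intro)
  let ?C = "connection_event M V E ends \<pi> r"
  show ?thesis
  proof (cases "1 - 2 * sqrt \<epsilon> \<le> 0")
    case True
    then have "(1 - 2 * sqrt \<epsilon>) * measure M (\<Union>b\<in>B. ?C b) \<le> 0"
      by (simp add: mult_nonpos_nonneg)
    then show ?thesis using measure_nonneg order_trans by blast
  next
    case False
    then have "sqrt \<epsilon> \<le> 1" by linarith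
    then have "\<epsilon> \<le> 1" by simp
    show ?thesis
    \<comment> \<open>A target equal to \<open>r\<close> has no place in the cyclic order, but then \<open>Ev r\<close> alone is likely enough.\<close>
    proof (cases "r \<in> B")
      case True
      have "?C r = space M"
      proof -
        have "joined_by_path V ends {e \<in> E. \<pi> e x} r r" for x
          by (subst joined_by_path_iff) (use ends_subset \<open>r \<in> V\<close> in auto)
        then show ?thesis by (simp add: connection_event_def)
      qed
      then have "Ev r \<subseteq> (\<Union>b\<in>B. ?C b \<inter> Ev b)"
        using True sets.sets_into_space[OF assms(11)] by blast
      moreover have "(\<Union>b\<in>B. ?C b \<inter> Ev b) \<in> sets M"
        using finite_subset[OF \<open>B \<subseteq> V\<close> finite_V] assms(2,11) ends_subset
        by (intro sets.finite_UN sets.Int sets_connection_event) auto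
      ultimately have "1 - \<epsilon> \<le> prob (\<Union>b\<in>B. ?C b \<inter> Ev b)"
        using assms(13)[OF True] finite_measure_mono order_trans by blast
      moreover have "(1 - 2 * sqrt \<epsilon>) * prob (\<Union>b\<in>B. ?C b) \<le> 1 - 2 * sqrt \<epsilon>"
        using False by (simp add: mult_left_le)
      moreover have "\<epsilon> \<le> 2 * sqrt \<epsilon>"
      proof -
        have "sqrt \<epsilon> * sqrt \<epsilon> \<le> 1 * sqrt \<epsilon>"
          using \<open>sqrt \<epsilon> \<le> 1\<close> \<open>0 < \<epsilon>\<close> by (intro mult_right_mono) auto
        then show ?thesis using \<open>0 < \<epsilon>\<close> by simp
      qed
      ultimately show ?thesis by linarith
    next
      case False
      obtain bs where bs: "set bs = B" "noncrossing_order ends E r bs"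
        using exists_noncrossing_order[OF assms(2,3) False] assms(7) by auto
      show ?thesis
        using connection_to_noncrossing_targets[OF ends_subset card_ends assms(2) bs(2) assms(10) \<open>\<epsilon> \<le> 1\<close>, of Ev]
          assms(11-13) bs(1) by simp
    qed
  qed
qed

end
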